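(* Let $m\ge 2$ be an integer, let $G=\mathrm{SL}(m+1,\mathbb{R})$, let $\Gamma\le G$ be a lattice, let $\Delta\le \mathrm{SL}(m,\mathbb{R})$ be a lattice, and let $$H=\left\{\begin{bmatrix} t^{-1/m}q & 0\\ v & t\end{bmatrix}: t>0,\ q\in\Delta,\ v\in\mathbb{R}^m\right\}\le G .$$ Then for every $x_0\in H\backslash G$ the orbit $x_0\Gamma$ is dense in $H\backslash G$.
   Context: Elements $v\in\mathbb{R}^m$ are row vectors, and matrices in $H$ are in block form with blocks of sizes $m$ and $1$. A lattice is a discrete subgroup of finite covolume. $\Gamma$ acts on $H\backslash G$ by right multiplication, $(Hg)\gamma=Hg\gamma$, and $H\backslash G$ carries the quotient topology. *)

theory Defs
  imports "HOL-Analysis.Analysis" "HOL-Algebra.Coset"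
begin

section \<open>The special linear group\<close>

definition SL :: "(real^'n^'n) monoid" where
  "SL = \<lparr>carrier = {A. det A = 1}, mult = (**), one = mat 1\<rparr>"

lemma SL_simps [simp]:
  "A \<in> carrier SL \<longleftrightarrow> det A = 1"
  "A \<otimes>\<^bsub>SL\<^esub> B = A ** B"
  "\<one>\<^bsub>SL\<^esub> = mat 1"
  by (simp_all add: SL_def)

lemma group_SL: "group (SL :: (real^'n^'n) monoid)"
proof (rule groupI)
  fix A :: "real^'n^'n"
  assume A: "A \<in> carrier SL"
  then have "invertible A"
    by (simp add: invertible_det_nz)
  then obtain B where B: "B ** A = mat 1"
    by (auto simp: invertible_def)
  have "det B * det A = 1"
    by (metis B det_I det_mul)
  with A B show "\<exists>B\<in>carrier SL. B \<otimes>\<^bsub>SL\<^esub> A = \<one>\<^bsub>SL\<^esub>"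
    by auto
qed (auto simp: det_mul matrix_mul_assoc)


section \<open>Coset spaces\<close>

definition quotient_topology :: "'a topology \<Rightarrow> ('a \<Rightarrow> 'b) \<Rightarrow> 'b topology" where
  "quotient_topology X f =
     topology (\<lambda>U. U \<subseteq> f ` topspace X \<and> openin X {x \<in> topspace X. f x \<in> U})"

lemma openin_quotient_topology:
  "openin (quotient_topology X f) U \<longleftrightarrow>
     U \<subseteq> f ` topspace X \<and> openin X {x \<in> topspace X. f x \<in> U}"
proof -
  have "istopology (\<lambda>U. U \<subseteq> f ` topspace X \<and> openin X {x \<in> topspace X. f x \<in> U})"
    unfolding istopology_def
  proof (intro conjI allI impI)
    fix S T
    assume "S \<subseteq> f ` topspace X \<and> openin X {x \<in> topspace X. f x \<in> S}"
      and "T \<subseteq> f ` topspace X \<and> openin X {x \<in> topspace X. f x \<in> T}"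
    moreover have "{x \<in> topspace X. f x \<in> S \<inter> T} =
        {x \<in> topspace X. f x \<in> S} \<inter> {x \<in> topspace X. f x \<in> T}"
      by auto
    ultimately show "S \<inter> T \<subseteq> f ` topspace X" "openin X {x \<in> topspace X. f x \<in> S \<inter> T}"
      by auto
  next
    fix \<K>
    assume K: "\<forall>K\<in>\<K>. K \<subseteq> f ` topspace X \<and> openin X {x \<in> topspace X. f x \<in> K}"
    then show "\<Union>\<K> \<subseteq> f ` topspace X"
      by blast
    have "{x \<in> topspace X. f x \<in> \<Union>\<K>} = (\<Union>K\<in>\<K>. {x \<in> topspace X. f x \<in> K})"
      by auto
    with K show "openin X {x \<in> topspace X. f x \<in> \<Union>\<K>}"
      by auto
  qed
  then show ?thesis
    by (simp add: quotient_topology_def topology_inverse')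
qed

lemma topspace_quotient_topology [simp]:
  "topspace (quotient_topology X f) = f ` topspace X"
proof
  have "{x \<in> topspace X. f x \<in> f ` topspace X} = topspace X"
    by blast
  then have "openin (quotient_topology X f) (f ` topspace X)"
    by (simp add: openin_quotient_topology)
  then show "f ` topspace X \<subseteq> topspace (quotient_topology X f)"
    by (rule openin_subset)
  show "topspace (quotient_topology X f) \<subseteq> f ` topspace X"
    using openin_topspace[of "quotient_topology X f"] unfolding openin_quotient_topology ..
qed

lemma quotient_map_quotient_topology:
  "quotient_map X (quotient_topology X f) f"
  by (auto simp: quotient_map_def openin_quotient_topology)

definition coset_topology ::
    "('a::topological_space, 'b) monoid_scheme \<Rightarrow> 'a set \<Rightarrow> 'a set topology" where
  "coset_topology G H = quotient_topology (top_of_set (carrier G)) (\<lambda>g. H #>\<^bsub>G\<^esub> g)"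

lemma topspace_coset_topology [simp]: "topspace (coset_topology G H) = rcosets\<^bsub>G\<^esub> H"
  by (auto simp: coset_topology_def RCOSETS_def)


section \<open>Lattices\<close>

text \<open>
  Finite covolume: the coset space carries a nonzero finite Borel measure that is invariant
  under right translation by the group.
\<close>

definition finite_covolume ::
    "('a::topological_space, 'b) monoid_scheme \<Rightarrow> 'a set \<Rightarrow> bool" where
  "finite_covolume G \<Gamma> \<longleftrightarrow>
     (\<exists>\<mu>. space \<mu> = rcosets\<^bsub>G\<^esub> \<Gamma> \<and>
          sets \<mu> = sigma_sets (rcosets\<^bsub>G\<^esub> \<Gamma>) {U. openin (coset_topology G \<Gamma>) U} \<and>
          finite_measure \<mu> \<and>
          emeasure \<mu> (space \<mu>) \<noteq> 0 \<and>
          (\<forall>g\<in>carrier G. \<forall>A\<in>sets \<mu>. emeasure \<mu> ((\<lambda>x. x #>\<^bsub>G\<^esub> g) ` A) = emeasure \<mu> A))"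

definition lattice_in ::
    "('a::topological_space, 'b) monoid_scheme \<Rightarrow> 'a set \<Rightarrow> bool" where
  "lattice_in G \<Gamma> \<longleftrightarrow> subgroup \<Gamma> G \<and> discrete \<Gamma> \<and> finite_covolume G \<Gamma>"


section \<open>The subgroup \<open>H\<close>\<close>

text \<open>
  Rows and columns of \<open>(m + 1) \<times> (m + 1)\<close> matrices are indexed by \<open>'m option\<close>, where
  \<open>CARD('m) = m\<close>: the indices \<open>Some i\<close> form the block of size \<open>m\<close> and \<open>None\<close> is the last index.
\<close>

definition block_lower ::
    "real^'m^'m \<Rightarrow> real^'m \<Rightarrow> real \<Rightarrow> real^('m option)^('m option)" where
  "block_lower A v d = (\<chi> i j.
     case (i, j) of
       (Some a, Some b) \<Rightarrow> A $ a $ b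
     | (Some a, None) \<Rightarrow> 0
     | (None, Some b) \<Rightarrow> v $ b
     | (None, None) \<Rightarrow> d)"

definition H_group :: "(real^'m^'m) set \<Rightarrow> (real^('m option)^('m option)) set" where
  "H_group \<Delta> =
     {block_lower ((t powr (- 1 / real CARD('m))) *\<^sub>R q) v t | t q v. t > 0 \<and> q \<in> \<Delta>}"

lemma block_lower_nth [simp]:
  "block_lower A v d $ Some a $ Some b = A $ a $ b"
  "block_lower A v d $ Some a $ None = 0"
  "block_lower A v d $ None $ Some b = v $ b"
  "block_lower A v d $ None $ None = d"
  by (simp_all add: block_lower_def)

lemma sum_UNIV_option:
  fixes f :: "'m::finite option \<Rightarrow> 'c::comm_monoid_add"
  shows "sum f UNIV = f None + (\<Sum>a\<in>UNIV. f (Some a))"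
  by (simp add: UNIV_option_conv sum.reindex)

lemma prod_UNIV_option:
  fixes f :: "'m::finite option \<Rightarrow> 'c::comm_monoid_mult"
  shows "prod f UNIV = f None * (\<Prod>a\<in>UNIV. f (Some a))"
  by (simp add: UNIV_option_conv prod.reindex)

lemma block_lower_mult:
  "block_lower A v d ** block_lower B w e = block_lower (A ** B) (v v* B + d *\<^sub>R w) (d * e)"
proof -
  have "(block_lower A v d ** block_lower B w e) $ i $ j =
        block_lower (A ** B) (v v* B + d *\<^sub>R w) (d * e) $ i $ j" for i j
    by (cases i; cases j)
      (simp_all add: matrix_matrix_mult_def vector_matrix_mult_def sum_UNIV_option mult.commute)
  then show ?thesis
    by (simp add: vec_eq_iff)
qed

lemma block_lower_one:
  "block_lower (mat 1) 0 1 = (mat 1 :: real^('m::finite option)^('m option))"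
proof -
  have "block_lower (mat 1) 0 1 $ i $ j = (mat 1 :: real^('m::finite option)^('m option)) $ i $ j" for i j
    by (cases i; cases j) (simp_all add: mat_def)
  then show ?thesis
    by (simp add: vec_eq_iff)
qed

lemma det_block_lower:
  fixes A :: "real^'m^'m"
  shows "det (block_lower A v d) = d * det A"
proof -
  let ?M = "block_lower A v d"
  let ?g = "\<lambda>p. of_int (sign p) * (\<Prod>i\<in>UNIV. ?M $ i $ p i)"
  let ?S = "range Some :: 'm option set"
  let ?h = "map_permutation UNIV (Some :: 'm \<Rightarrow> 'm option)"
  have bij: "bij_betw Some (UNIV :: 'm set) ?S"
    by (simp add: bij_betw_def)
  have inj: "inj_on ?h {p. p permutes UNIV}"
    by (rule inj_on_inverseI[where g = "map_permutation ?S the"])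
       (simp add: map_permutation_compose_inv[OF bij])
  have onto: "?h ` {p. p permutes UNIV} = {p. p permutes ?S}"
  proof
    show "?h ` {p. p permutes UNIV} \<subseteq> {p. p permutes ?S}"
      using map_permutation_permutes[OF bij] by blast
    show "{p. p permutes ?S} \<subseteq> ?h ` {p. p permutes UNIV}"
    proof
      fix p assume p: "p \<in> {p. p permutes ?S}"
      have bij': "bij_betw the ?S (UNIV :: 'm set)"
        by (rule bij_betwI[where g = Some]) auto
      have "map_permutation ?S the p permutes UNIV"
        using p map_permutation_permutes[OF bij'] by blast
      moreover have "?h (map_permutation ?S the p) = p"
        using p by (intro map_permutation_compose_inv[OF bij']) auto
      ultimately show "p \<in> ?h ` {p. p permutes UNIV}"
        by (metis image_eqI mem_Collect_eq)
    qed
  qed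
  have "det ?M = sum ?g {p. p permutes UNIV}"
    by (simp add: det_def)
  also have "\<dots> = sum ?g {p. p permutes ?S}"
  proof (rule sum.mono_neutral_right)
    show "finite {p. p permutes (UNIV :: 'm option set)}"
      by (simp add: finite_permutations)
    show "{p. p permutes ?S} \<subseteq> {p. p permutes UNIV}"
      using permutes_subset by blast
    show "\<forall>p\<in>{p. p permutes UNIV} - {p. p permutes ?S}. ?g p = 0"
    proof
      fix p assume p: "p \<in> {p. p permutes (UNIV :: 'm option set)} - {p. p permutes ?S}"
      have ne: "p None \<noteq> None"
      proof
        assume "p None = None"
        then have "p x = x" if "x \<in> UNIV - ?S" for x
          using that by (cases x) auto
        moreover have "p permutes UNIV"
          using p by blast
        ultimately have "p permutes ?S"
          using permutes_superset by blast
        with p show False by simp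
      qed
      obtain i where i: "p i = None"
      proof -
        have "surj p"
          using p permutes_surj by blast
        then show thesis
          using that by (metis surjD)
      qed
      with ne obtain a where "i = Some a"
        by (cases i) auto
      with i have "?M $ i $ p i = 0"
        by simp
      then have "(\<Prod>i\<in>UNIV. ?M $ i $ p i) = 0"
        by (intro prod_zero) auto
      then show "?g p = 0"
        by simp
    qed
  qed
  also have "\<dots> = (\<Sum>p\<in>{p. p permutes UNIV}. ?g (?h p))"
    unfolding onto[symmetric] by (simp add: sum.reindex[OF inj])
  also have "\<dots> = (\<Sum>p\<in>{p. p permutes UNIV}. d * (of_int (sign p) * (\<Prod>a\<in>UNIV. A $ a $ p a)))"
  proof (rule sum.cong)
    fix p assume "p \<in> {p. p permutes (UNIV :: 'm set)}"
    then have p: "p permutes (UNIV :: 'm set)" by simp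
    have "?h p None = None"
      using map_permutation_permutes[OF bij p] by (rule permutes_not_in) auto
    moreover have "?h p (Some a) = Some (p a)" for a
      by (simp add: map_permutation_apply)
    moreover have "sign (?h p) = sign p"
      using p by (simp add: sign_map_permutation)
    ultimately show "?g (?h p) = d * (of_int (sign p) * (\<Prod>a\<in>UNIV. A $ a $ p a))"
      by (simp add: prod_UNIV_option)
  qed simp
  also have "\<dots> = d * det A"
    by (simp add: det_def sum_distrib_left)
  finally show ?thesis .
qed

lemma subgroup_H_group:
  fixes \<Delta> :: "(real^'m^'m) set"
  assumes "subgroup \<Delta> SL"
  shows "subgroup (H_group \<Delta>) SL"
proof -
  interpret SLm: group "SL :: (real^'m^'m) monoid" by (rule group_SL)
  interpret SLm1: group "SL :: (real^('m option)^('m option)) monoid" by (rule group_SL)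
  interpret D: subgroup \<Delta> SL by fact
  define s :: "real \<Rightarrow> real" where "s t = t powr (- 1 / real CARD('m))" for t
  have scale_mult: "(a *\<^sub>R A) ** (b *\<^sub>R B) = (a * b) *\<^sub>R (A ** B)"
    for a b and A B :: "real^'m^'m"
    by (simp add: vec_eq_iff matrix_matrix_mult_def sum_distrib_left mult_ac)
  have det_scale: "det (c *\<^sub>R q) = c ^ CARD('m) * det q" for c and q :: "real^'m^'m"
  proof -
    have "c *\<^sub>R q = (\<chi> i. c *s q $ i)"
      by (simp add: vec_eq_iff)
    then show ?thesis
      using det_rows_mul[of "\<lambda>_. c" "\<lambda>i. q $ i"] by simp
  qed
  have det_D: "det q = 1" if "q \<in> \<Delta>" for q
    using D.subset that by auto
  have one_in: "mat 1 \<in> \<Delta>"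
    using D.one_closed by simp
  have mult_in: "p ** q \<in> \<Delta>" if "p \<in> \<Delta>" "q \<in> \<Delta>" for p q
    using D.m_closed[OF that] by simp
  have pow: "s t ^ CARD('m) = inverse t" if "t > 0" for t
  proof -
    have "s t ^ CARD('m) = s t powr real CARD('m)"
      using that by (intro powr_realpow[symmetric]) (simp add: s_def)
    also have "\<dots> = t powr (- 1)"
      unfolding s_def powr_powr by simp
    finally show ?thesis
      using that by (simp add: powr_minus)
  qed
  have in_SL: "H_group \<Delta> \<subseteq> carrier SL"
    unfolding H_group_def s_def[symmetric]
    by (auto simp: det_block_lower det_scale det_D pow)
  have s_mult: "s (t * u) = s t * s u" if "t > 0" "u > 0" for t u
    using that by (simp add: s_def powr_mult)
  have mem: "block_lower (s t *\<^sub>R q) v t \<in> H_group \<Delta>" if "t > 0" "q \<in> \<Delta>" for t q v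
    using that by (auto simp: H_group_def s_def)
  show ?thesis
  proof (rule SLm1.subgroupI[OF in_SL])
    show "H_group \<Delta> \<noteq> {}"
      using mem[OF zero_less_one one_in] by blast
  next
    fix X Y assume "X \<in> H_group \<Delta>" "Y \<in> H_group \<Delta>"
    then obtain t q v u r w where
      X: "X = block_lower (s t *\<^sub>R q) v t" "t > 0" "q \<in> \<Delta>" and
      Y: "Y = block_lower (s u *\<^sub>R r) w u" "u > 0" "r \<in> \<Delta>"
      unfolding H_group_def s_def by blast
    have "(s t *\<^sub>R q) ** (s u *\<^sub>R r) = s (t * u) *\<^sub>R (q ** r)"
      by (simp add: s_mult[OF X(2) Y(2)] scale_mult)
    then have "X ** Y = block_lower (s (t * u) *\<^sub>R (q ** r))
        (v v* (s u *\<^sub>R r) + t *\<^sub>R w) (t * u)"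
      by (simp add: X Y block_lower_mult)
    then show "X \<otimes>\<^bsub>SL\<^esub> Y \<in> H_group \<Delta>"
      using mem[OF _ mult_in[OF X(3) Y(3)], of "t * u"] X(2) Y(2) by simp
  next
    fix X assume XH: "X \<in> H_group \<Delta>"
    then obtain t q v where
      X: "X = block_lower (s t *\<^sub>R q) v t" "t > 0" "q \<in> \<Delta>"
      unfolding H_group_def s_def by blast
    define r where "r = inv\<^bsub>SL\<^esub> q"
    have r: "r \<in> \<Delta>" "r ** q = mat 1"
      using X(3) D.m_inv_closed[OF X(3)] D.subset SLm.l_inv[of q] by (auto simp: r_def)
    define w where "w = - (inverse t *\<^sub>R v) v* (s (inverse t) *\<^sub>R r)"
    let ?Y = "block_lower (s (inverse t) *\<^sub>R r) w (inverse t)"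
    have "(s (inverse t) *\<^sub>R r) ** (s t *\<^sub>R q) = (s (inverse t) * s t) *\<^sub>R (r ** q)"
      by (rule scale_mult)
    also have "\<dots> = mat 1"
      using X(2) s_mult[of "inverse t" t] by (simp add: r s_def)
    finally have inv: "(s (inverse t) *\<^sub>R r) ** (s t *\<^sub>R q) = mat 1" .
    have w: "w v* (s t *\<^sub>R q) + inverse t *\<^sub>R v = 0"
      unfolding w_def vector_matrix_mul_assoc inv by simp
    have "?Y ** X = mat 1"
      using X(2) w inv by (simp add: X(1) block_lower_mult block_lower_one)
    moreover have Y: "?Y \<in> H_group \<Delta>"
      using X(2) r(1) by (intro mem) auto
    ultimately have "inv\<^bsub>SL\<^esub> X = ?Y"
      using in_SL XH by (intro SLm1.inv_equality) auto
    with Y show "inv\<^bsub>SL\<^esub> X \<in> H_group \<Delta>"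
      by simp
  qed
qed

end

theory Submission
  imports Defs
begin

text \<open>
  Only elements of \<open>H\<close> with \<open>q = 1\<close> are needed: the powers of one diagonal matrix \<open>a\<close> and the
  unipotent group \<open>U\<close> that \<open>a\<close> expands generate a group all of whose orbits on \<open>\<Gamma>\G\<close> are already dense. For an open
  set \<open>W\<close> of \<open>\<Gamma>\G\<close> the union \<open>E\<close> of the translates \<open>W a\<^sup>n\<close>, \<open>n \<ge> 0\<close>, is mapped into itself by
  \<open>a\<close>, hence invariant up to null sets, since the measure is finite. By the Mautner phenomenon \<open>E\<close> is
  also invariant, up to null sets, under the transvections that \<open>a\<close> expands or contracts. These
  generate \<open>SL(m+1,\<real>)\<close>, so \<open>E\<close> meets every nonempty open set. Applied to a small box \<open>W\<close> around a
  given point, this shows that the orbit of that point is dense, because \<open>a\<close> does not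
  expand the directions complementary to \<open>U\<close>. Inversion turns density of \<open>\<Gamma>g\<^sup>-\<^sup>1H\<close> into
  density of \<open>Hg\<Gamma>\<close>.
\<close>

section \<open>Continuity of the matrix operations\<close>

lemma tendsto_matrix_matrix_mult [tendsto_intros]:
  fixes f :: "'a \<Rightarrow> real^'n^'m" and g :: "'a \<Rightarrow> real^'k^'n"
  assumes "(f \<longlongrightarrow> A) F" "(g \<longlongrightarrow> B) F"
  shows "((\<lambda>x. f x ** g x) \<longlongrightarrow> A ** B) F"
  unfolding matrix_matrix_mult_def by (intro tendsto_intros assms)

lemma tendsto_vector_matrix_mult [tendsto_intros]:
  fixes f :: "'a \<Rightarrow> real^'m" and g :: "'a \<Rightarrow> real^'n^'m"
  assumes "(f \<longlongrightarrow> v) F" "(g \<longlongrightarrow> A) F"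
  shows "((\<lambda>x. f x v* g x) \<longlongrightarrow> v v* A) F"
  unfolding vector_matrix_mult_def by (intro tendsto_intros assms)

lemma tendsto_det [tendsto_intros]:
  fixes f :: "'a \<Rightarrow> real^'n^'n"
  assumes "(f \<longlongrightarrow> A) F"
  shows "((\<lambda>x. det (f x)) \<longlongrightarrow> det A) F"
  unfolding det_def by (intro tendsto_intros assms)

text \<open>Column j of the inverse solves A x = e_j, and Cramer's rule writes its entries as
  quotients of determinants. In this form inversion is visibly continuous wherever det A is
  nonzero.\<close>

definition cramer_inverse :: "real^'n^'n \<Rightarrow> real^'n^'n" where
  "cramer_inverse A =
     (\<chi> i j. det (\<chi> r c. if c = i then mat 1 $ r $ j else A $ r $ c) / det A)"

lemma tendsto_cramer_inverse:
  fixes f :: "'a \<Rightarrow> real^'n^'n"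
  assumes "(f \<longlongrightarrow> A) F" "det A \<noteq> 0"
  shows "((\<lambda>x. cramer_inverse (f x)) \<longlongrightarrow> cramer_inverse A) F"
proof -
  have *: "((\<lambda>x. if c then a else f x $ r $ k) \<longlongrightarrow> (if c then a else A $ r $ k)) F" for c a r k
    by (cases c) (auto intro!: tendsto_intros assms)
  show ?thesis
    unfolding cramer_inverse_def by (intro tendsto_intros assms *)
qed

lemma matrix_mul_cramer_inverse:
  fixes A :: "real^'n^'n"
  assumes "det A \<noteq> 0"
  shows "A ** cramer_inverse A = mat 1" "cramer_inverse A ** A = mat 1"
proof -
  have "A *v column j (cramer_inverse A) = column j (mat 1)" for j
    unfolding cramer[OF assms] by (simp add: cramer_inverse_def column_def cong: if_cong)
  then show *: "A ** cramer_inverse A = mat 1"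
    by (simp add: vec_eq_iff matrix_matrix_mult_def matrix_vector_mult_def column_def)
  show "cramer_inverse A ** A = mat 1"
    using * by (simp add: matrix_left_right_inverse)
qed

lemma inv_SL_eq_cramer_inverse:
  fixes A :: "real^'n^'n"
  assumes "det A = 1"
  shows "inv\<^bsub>SL\<^esub> A = cramer_inverse A"
proof -
  interpret group "SL :: (real^'n^'n) monoid" by (rule group_SL)
  have *: "cramer_inverse A ** A = mat 1"
    using matrix_mul_cramer_inverse(2)[of A] assms by simp
  have "det (cramer_inverse A) = 1"
    using arg_cong[OF *, of det] assms by (simp add: det_mul)
  then show ?thesis
    using * assms by (intro inv_equality) auto
qed

lemma tendsto_inv_SL:
  fixes f :: "'a \<Rightarrow> real^'n^'n"
  assumes "(f \<longlongrightarrow> A) F" "\<And>x. det (f x) = 1" "det A = 1"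
  shows "((\<lambda>x. inv\<^bsub>SL\<^esub> (f x)) \<longlongrightarrow> inv\<^bsub>SL\<^esub> A) F"
  using tendsto_cramer_inverse[OF assms(1)] assms by (simp add: inv_SL_eq_cramer_inverse)

section \<open>Transvections\<close>

definition transvection :: "'n \<Rightarrow> 'n \<Rightarrow> real \<Rightarrow> real^'n^'n" where
  "transvection i j c = (\<chi> k l. mat 1 $ k $ l + (if k = i \<and> l = j then c else 0))"

lemma transvection_mult_nth:
  fixes A :: "real^'n^'n"
  shows "(transvection i j c ** A) $ k $ l = A $ k $ l + (if k = i then c * A $ j $ l else 0)"
proof -
  have "(transvection i j c ** A) $ k $ l =
    (\<Sum>r\<in>UNIV. (if k = r then A $ r $ l else 0) + (if r = j then (if k = i then c * A $ r $ l else 0) else 0))"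
    by (auto simp: matrix_matrix_mult_def transvection_def mat_def intro!: sum.cong)
       (auto simp: algebra_simps)
  then show ?thesis
    by (simp add: sum.distrib)
qed

lemma transvection_cancel:
  fixes A :: "real^'n^'n"
  assumes "i \<noteq> j"
  shows "transvection i j c ** (transvection i j (- c) ** A) = A"
  using assms by (auto simp: vec_eq_iff transvection_mult_nth)

lemma det_transvection:
  assumes "i \<noteq> j"
  shows "det (transvection i j c :: real^'n^'n) = 1"
proof -
  have "transvection i j c = (\<chi> k. if k = i then row i (mat 1) + c *s row j (mat 1) else row k (mat 1 :: real^'n^'n))"
    using assms by (auto simp: vec_eq_iff transvection_def row_def mat_def)
  then show ?thesis
    using det_row_operation[OF assms, of "mat 1" c] by simp
qed

text \<open>Commutators through a middle index j produce the transvections that avoid j;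
  \<open>stabilizer_full\<close> takes its distinguished index as j. Nesting to the right lets
  \<open>transvection_mult_nth\<close> evaluate the product factor by factor.\<close>

lemma transvection_commutator:
  assumes "i \<noteq> j" "j \<noteq> k" "i \<noteq> k"
  shows "transvection i j c ** (transvection j k 1 ** (transvection i j (- c) ** transvection j k (- 1)))
         = (transvection i k c :: real^'n^'n)"
  using assms
  by (auto simp: vec_eq_iff transvection_mult_nth) (auto simp: transvection_def mat_def)

text \<open>Gaussian elimination by row operations alone; in the proof, \<open>C\<close> holds the columns that may
  still differ from those of the identity matrix.\<close>

lemma SL_induct_transvection:
  fixes A :: "real^'n^'n"
  assumes "det A = 1" and one: "P (mat 1)"
    and mult: "\<And>i j c A. i \<noteq> j \<Longrightarrow> det A = 1 \<Longrightarrow> P A \<Longrightarrow> P (transvection i j c ** A)"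
  shows "P A"
proof -
  \<comment> \<open>Row operations are undone by row operations, so P may be proved after applying
    one.\<close>
  have step: "P A" if "P (transvection i j c ** A)" "i \<noteq> j" "det A = 1" for i j c A
    using mult[OF that(2) _ that(1), of "- c"] that(2,3) transvection_cancel[of i j "- c" A]
    by (simp add: det_mul det_transvection)
  \<comment> \<open>Once the pivot in column k is 1, multiples of row k clear the rest of that
    column. The finished columns, those in S, survive because row k is zero there.\<close>
  have clear: "P A"
    if A: "det A = 1" and k: "k \<notin> S" "A $ k $ k = 1"
      and S: "\<And>i j. j \<in> S \<Longrightarrow> A $ i $ j = mat 1 $ i $ j"
      and IH: "\<And>B. det B = 1 \<Longrightarrow>
                (\<And>i j. j \<in> insert k S \<Longrightarrow> B $ i $ j = mat 1 $ i $ j) \<Longrightarrow> P B"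
    for A S k
  proof -
    \<comment> \<open>R holds the rows whose entry in column k may still be wrong.\<close>
    have "P A" if "finite R" "\<And>i. i \<notin> R \<Longrightarrow> A $ i $ k = mat 1 $ i $ k" "k \<notin> R"
        "A $ k $ k = 1" "det A = 1" "\<And>i j. j \<in> S \<Longrightarrow> A $ i $ j = mat 1 $ i $ j" for R A
      using that
    proof (induction R arbitrary: A rule: finite_induct)
      case empty
      then show ?case by (intro IH) auto
    next
      case (insert r R)
      have r: "r \<noteq> k" using insert by auto
      have "P (transvection r k (- A $ r $ k) ** A)"
      proof (rule insert.IH)
        show "(transvection r k (- A $ r $ k) ** A) $ i $ k = mat 1 $ i $ k" if "i \<notin> R" for i
          using insert.prems that r by (auto simp: transvection_mult_nth mat_def)
        show "(transvection r k (- A $ r $ k) ** A) $ i $ j = mat 1 $ i $ j" if "j \<in> S" for i j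
          using insert.prems(5)[OF that] that k(1) by (auto simp: transvection_mult_nth mat_def)
      qed (use insert.prems r in \<open>auto simp: transvection_mult_nth det_mul det_transvection\<close>)
      then show ?case
        using step r insert.prems by blast
    qed
    from this[of "UNIV - {k}" A] show ?thesis
      using A k S by (auto simp: mat_def)
  qed
  have "P A" if "finite C" "det A = 1" "\<And>i j. j \<notin> C \<Longrightarrow> A $ i $ j = mat 1 $ i $ j" for C A
    using that
  proof (induction C arbitrary: A rule: finite_induct)
    case empty
    then have "A = mat 1" by (simp add: vec_eq_iff)
    then show ?case using one by simp
  next
    case (insert k C)
    have col: "A $ i $ j = mat 1 $ i $ j" if "j \<in> - insert k C" for i j
      using insert.prems that by auto
    have clear': "P B" if "det B = 1" "B $ k $ k = 1"
      "\<And>i j. j \<in> - insert k C \<Longrightarrow> B $ i $ j = mat 1 $ i $ j" for B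
    proof (rule clear[OF that(1) _ that(2,3)])
      fix B' :: "real^'n^'n"
      assume B': "det B' = 1" "\<And>i j. j \<in> insert k (- insert k C) \<Longrightarrow> B' $ i $ j = mat 1 $ i $ j"
      show "P B'"
        by (rule insert.IH[OF B'(1)], rule B'(2)) (use insert.hyps in auto)
    qed auto
    \<comment> \<open>A nonzero entry in row j of column k allows one row operation to make the
      pivot 1. Since j is in C, row j vanishes in the finished columns, which are therefore
      kept.\<close>
    have pivot: "P B" if B: "det B = 1" "\<And>i j. j \<in> - insert k C \<Longrightarrow> B $ i $ j = mat 1 $ i $ j"
      and j: "j \<in> C" "B $ j $ k \<noteq> 0" for B j
    proof -
      have jk: "k \<noteq> j" using j insert.hyps by auto
      have "P (transvection k j ((1 - B $ k $ k) / B $ j $ k) ** B)"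
      proof (rule clear')
        show "(transvection k j ((1 - B $ k $ k) / B $ j $ k) ** B) $ i $ l = mat 1 $ i $ l"
          if "l \<in> - insert k C" for i l
          using B(2)[OF that] that j by (auto simp: transvection_mult_nth mat_def)
      qed (use B j jk in \<open>auto simp: transvection_mult_nth det_mul det_transvection\<close>)
      then show ?thesis
        using step jk B(1) by blast
    qed
    show ?case
    proof (cases "\<exists>j\<in>C. A $ j $ k \<noteq> 0")
      case True
      then show ?thesis using pivot insert.prems(1) col by blast
    next
      case False
      show ?thesis
      proof (cases "C = {}")
        case True
        \<comment> \<open>All other columns are those of the identity, so det A is the pivot itself,
          which must then be 1.\<close>
        have "A = (\<chi> i j. if j = k then (mat 1 *v column k A) $ i else mat 1 $ i $ j)"
          using col True by (auto simp: vec_eq_iff column_def)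
        then have "det A = column k A $ k"
          using cramer_lemma[where A = "mat 1" and x = "column k A" and k = k] by simp
        then show ?thesis
          using clear' insert.prems(1) col by (simp add: column_def)
      next
        case ne: False
        then obtain l where l: "l \<in> C" by auto
        have lk: "l \<noteq> k" using l insert.hyps by auto
        have "A $ k $ k \<noteq> 0"
        proof
          assume 0: "A $ k $ k = 0"
          \<comment> \<open>If the pivot were zero as well, column k would be a combination of the
            finished columns. The vector x records this relation; as a nonzero kernel vector it
            contradicts det A = 1.\<close>
          define x :: "real^'n" where
            "x = (\<chi> j. if j = k then 1 else if j \<in> C then 0 else - A $ j $ k)"
          have "A *v x = 0"
          proof -
            have "(A *v x) $ i = 0" for i
            proof -
              have "(A *v x) $ i = (\<Sum>j\<in>UNIV. (if j = k then A $ i $ j else 0) +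
                  (if i = j then (if j \<in> insert k C then 0 else - A $ j $ k) else 0))"
                unfolding matrix_vector_mult_def x_def
                by (auto simp: col mat_def intro!: sum.cong)
              also have "\<dots> = 0"
                using False 0 by (auto simp: sum.distrib)
              finally show ?thesis .
            qed
            then show ?thesis by (simp add: vec_eq_iff)
          qed
          moreover have "x \<noteq> 0"
          proof -
            have "x $ k = 1" by (simp add: x_def)
            then show ?thesis by auto
          qed
          ultimately show False
            using insert.prems(1) matrix_left_invertible_ker[of A]
            by (metis invertible_det_nz invertible_left_inverse zero_neq_one)
        qed
        \<comment> \<open>Adding row k to row l puts the nonzero diagonal entry into a row of C,
          where \<open>pivot\<close> applies.\<close>
        then have "P (transvection l k 1 ** A)"
          using insert.prems(1) col l lk False
          by (intro pivot[of _ l])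
             (auto simp: transvection_mult_nth det_mul det_transvection mat_def)
        then show ?thesis
          using step lk insert.prems(1) by blast
      qed
    qed
  qed
  from this[of UNIV A] show ?thesis using assms(1) by simp
qed

section \<open>Quotients of the special linear group of finite volume\<close>

lemma openin_tendstoD:
  assumes "openin (top_of_set S) U" "(f \<longlongrightarrow> l) F" "\<And>x. f x \<in> S" "l \<in> U"
  shows "eventually (\<lambda>x. f x \<in> U) F"
proof -
  obtain T where T: "open T" "U = S \<inter> T"
    using assms(1) by (auto simp: openin_open)
  then have "eventually (\<lambda>x. f x \<in> T) F"
    using assms topological_tendstoD by blast
  then show ?thesis
    using T assms(3) by simp
qed

lemma openin_SL_mult_preimage:
  fixes g h :: "real^'n^'n"
  assumes "openin (top_of_set (carrier SL)) U" "det g = 1" "det h = 1"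
  shows "openin (top_of_set (carrier SL)) {x. det x = 1 \<and> g ** x ** h \<in> U}"
proof -
  have "continuous_on (carrier SL) (\<lambda>x. g ** x ** h)"
    unfolding continuous_on_def by (intro ballI tendsto_intros)
  moreover have "(\<lambda>x. g ** x ** h) \<in> carrier SL \<rightarrow> carrier SL"
    using assms by (auto simp: det_mul)
  ultimately have "openin (top_of_set (carrier SL)) (carrier SL \<inter> (\<lambda>x. g ** x ** h) -` U)"
    using assms(1) by (rule continuous_openin_preimage)
  moreover have "carrier SL \<inter> (\<lambda>x. g ** x ** h) -` U = {x. det x = 1 \<and> g ** x ** h \<in> U}"
    by auto
  ultimately show ?thesis by simp
qed

lemma openin_coset_topology_SL:
  "openin (coset_topology SL H) U \<longleftrightarrow>
     U \<subseteq> rcosets\<^bsub>SL\<^esub> H \<and> openin (top_of_set (carrier SL)) {g. det g = 1 \<and> H #>\<^bsub>SL\<^esub> g \<in> U}"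
proof -
  have "(\<lambda>g. H #>\<^bsub>SL\<^esub> g) ` carrier SL = rcosets\<^bsub>SL\<^esub> H"
    by (auto simp: RCOSETS_def)
  then show ?thesis
    by (simp add: coset_topology_def openin_quotient_topology)
qed

lemma det_inv_SL: "det g = 1 \<Longrightarrow> det (inv\<^bsub>SL\<^esub> g) = 1" for g :: "real^'n^'n"
  using group.inv_closed[OF group_SL, of g] by simp

lemma inv_SL_mult:
  fixes g :: "real^'n^'n"
  assumes "det g = 1" shows "inv\<^bsub>SL\<^esub> g ** g = mat 1" "g ** inv\<^bsub>SL\<^esub> g = mat 1"
  using group.l_inv[OF group_SL, of g] group.r_inv[OF group_SL, of g] assms by auto

lemma SL_rcos_eq_iff:
  fixes g h :: "real^'n^'n"
  assumes H: "subgroup H SL" and "det g = 1" "det h = 1"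
  shows "H #>\<^bsub>SL\<^esub> g = H #>\<^bsub>SL\<^esub> h \<longleftrightarrow> (\<exists>\<gamma>\<in>H. g = \<gamma> ** h)"
proof
  assume "H #>\<^bsub>SL\<^esub> g = H #>\<^bsub>SL\<^esub> h"
  moreover have "g \<in> H #>\<^bsub>SL\<^esub> g"
    using group.rcos_self[OF group_SL, of g H] assms by simp
  ultimately show "\<exists>\<gamma>\<in>H. g = \<gamma> ** h"
    by (auto simp: r_coset_def)
next
  assume "\<exists>\<gamma>\<in>H. g = \<gamma> ** h"
  then have "g \<in> H #>\<^bsub>SL\<^esub> h"
    by (auto simp: r_coset_def)
  then show "H #>\<^bsub>SL\<^esub> g = H #>\<^bsub>SL\<^esub> h"
    using group.repr_independence[OF group_SL, of g H h] assms by simp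
qed

locale SL_homogeneous_space =
  fixes \<Gamma> :: "(real^'n^'n) set" and \<mu> :: "(real^'n^'n) set measure"
  assumes subgroup: "subgroup \<Gamma> SL"
    and space: "space \<mu> = rcosets\<^bsub>SL\<^esub> \<Gamma>"
    and sets: "sets \<mu> = sigma_sets (rcosets\<^bsub>SL\<^esub> \<Gamma>) {U. openin (coset_topology SL \<Gamma>) U}"
    and finite: "finite_measure \<mu>"
    and nonzero: "emeasure \<mu> (space \<mu>) \<noteq> 0"
    and invariant: "\<And>g A. det g = 1 \<Longrightarrow> A \<in> sets \<mu> \<Longrightarrow>
                      emeasure \<mu> ((\<lambda>x. x #>\<^bsub>SL\<^esub> g) ` A) = emeasure \<mu> A"
begin

sublocale finite_measure \<mu> by (rule finite)

sublocale SL: group "SL :: (real^'n^'n) monoid" by (rule group_SL)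

abbreviation X :: "(real^'n^'n) set set" where "X \<equiv> rcosets\<^bsub>SL\<^esub> \<Gamma>"

abbreviation proj :: "real^'n^'n \<Rightarrow> (real^'n^'n) set" where "proj g \<equiv> \<Gamma> #>\<^bsub>SL\<^esub> g"

section \<open>Right translation on the coset space\<close>

definition translate :: "real^'n^'n \<Rightarrow> (real^'n^'n) set set \<Rightarrow> (real^'n^'n) set set" where
  "translate g A = (\<lambda>x. x #>\<^bsub>SL\<^esub> g) ` A"

lemma det_\<Gamma>: "\<gamma> \<in> \<Gamma> \<Longrightarrow> det \<gamma> = 1"
  using subgroup.subset[OF subgroup] by auto

lemma proj_in_X: "det g = 1 \<Longrightarrow> proj g \<in> X"
  by (auto simp: RCOSETS_def)

lemma X_cases:
  assumes "x \<in> X"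
  obtains g where "det g = 1" "x = proj g"
  using assms by (auto simp: RCOSETS_def)

lemma proj_mult: "det g = 1 \<Longrightarrow> det h = 1 \<Longrightarrow> proj g #>\<^bsub>SL\<^esub> h = proj (g ** h)"
  using SL.coset_mult_assoc[of \<Gamma> g h] subgroup.subset[OF subgroup] by auto

lemma proj_eq_iff:
  "det g = 1 \<Longrightarrow> det h = 1 \<Longrightarrow> proj g = proj h \<longleftrightarrow> (\<exists>\<gamma>\<in>\<Gamma>. g = \<gamma> ** h)"
  by (rule SL_rcos_eq_iff[OF subgroup])

lemma translate_subset: "A \<subseteq> X \<Longrightarrow> det g = 1 \<Longrightarrow> translate g A \<subseteq> X"
  unfolding translate_def
  by (auto simp: proj_mult det_mul intro!: proj_in_X dest!: subsetD elim!: X_cases)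

lemma translate_translate:
  assumes "A \<subseteq> X" "det g = 1" "det h = 1"
  shows "translate h (translate g A) = translate (g ** h) A"
proof -
  have "(x #>\<^bsub>SL\<^esub> g) #>\<^bsub>SL\<^esub> h = x #>\<^bsub>SL\<^esub> (g ** h)" if "x \<in> A" for x
    using that assms
    by (auto simp: proj_mult det_mul matrix_mul_assoc elim!: X_cases[of x] dest!: subsetD)
  then show ?thesis
    by (auto simp: translate_def image_image)
qed

lemma translate_one: "A \<subseteq> X \<Longrightarrow> translate (mat 1) A = A"
proof -
  assume A: "A \<subseteq> X"
  have "x #>\<^bsub>SL\<^esub> mat 1 = x" if "x \<in> A" for x
    using that A by (auto simp: proj_mult elim!: X_cases[of x] dest!: subsetD)
  then show ?thesis
    by (simp add: translate_def)
qed

lemma mem_translate_iff: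
  assumes "A \<subseteq> X" "det g = 1" "det y = 1"
  shows "proj y \<in> translate g A \<longleftrightarrow> proj (y ** inv\<^bsub>SL\<^esub> g) \<in> A"
proof
  assume "proj y \<in> translate g A"
  then obtain x where x: "x \<in> A" "proj y = x #>\<^bsub>SL\<^esub> g"
    by (auto simp: translate_def)
  then obtain z where z: "det z = 1" "x = proj z"
    using assms X_cases by blast
  have "proj (y ** inv\<^bsub>SL\<^esub> g) = proj y #>\<^bsub>SL\<^esub> inv\<^bsub>SL\<^esub> g"
    using assms by (simp add: proj_mult det_inv_SL)
  also have "\<dots> = proj (z ** (g ** inv\<^bsub>SL\<^esub> g))"
    using assms x z by (simp add: proj_mult det_inv_SL det_mul matrix_mul_assoc)
  finally show "proj (y ** inv\<^bsub>SL\<^esub> g) \<in> A"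
    using x z assms by (simp add: inv_SL_mult)
next
  assume "proj (y ** inv\<^bsub>SL\<^esub> g) \<in> A"
  moreover have "proj (y ** inv\<^bsub>SL\<^esub> g) #>\<^bsub>SL\<^esub> g = proj y"
    using assms by (simp add: proj_mult det_inv_SL det_mul inv_SL_mult flip: matrix_mul_assoc)
  ultimately show "proj y \<in> translate g A"
    by (force simp: translate_def)
qed

lemma translate_inj:
  assumes "det g = 1"
  shows "inj_on (\<lambda>x. x #>\<^bsub>SL\<^esub> g) X"
proof (rule inj_on_inverseI[where g = "\<lambda>x. x #>\<^bsub>SL\<^esub> inv\<^bsub>SL\<^esub> g"])
  show "x #>\<^bsub>SL\<^esub> g #>\<^bsub>SL\<^esub> inv\<^bsub>SL\<^esub> g = x" if "x \<in> X" for x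
    using that assms
    by (auto simp: proj_mult det_mul det_inv_SL inv_SL_mult elim!: X_cases simp flip: matrix_mul_assoc)
qed

lemma translate_diff:
  assumes "A \<subseteq> X" "B \<subseteq> X" "det g = 1"
  shows "translate g (A - B) = translate g A - translate g B"
  unfolding translate_def
  by (rule inj_on_image_set_diff[OF translate_inj[OF assms(3)]]) (use assms in auto)

lemma openin_translate:
  assumes "openin (coset_topology SL \<Gamma>) U" "det g = 1"
  shows "openin (coset_topology SL \<Gamma>) (translate g U)"
proof -
  have U: "U \<subseteq> X" "openin (top_of_set (carrier SL)) {g. det g = 1 \<and> proj g \<in> U}"
    using assms by (auto simp: openin_coset_topology_SL)
  have "{y. det y = 1 \<and> proj y \<in> translate g U} =
      {y. det y = 1 \<and> mat 1 ** y ** inv\<^bsub>SL\<^esub> g \<in> {g. det g = 1 \<and> proj g \<in> U}}"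
    using assms U by (auto simp: mem_translate_iff det_mul det_inv_SL)
  then show ?thesis
    using openin_SL_mult_preimage[OF U(2), of "mat 1" "inv\<^bsub>SL\<^esub> g"] translate_subset[OF U(1)] assms
    by (simp add: openin_coset_topology_SL det_inv_SL)
qed

lemma openin_proj_image:
  assumes "openin (top_of_set (carrier SL)) W"
  shows "openin (coset_topology SL \<Gamma>) (proj ` W)"
proof -
  have W: "W \<subseteq> carrier SL"
    using openin_imp_subset[OF assms] .
  have "{y. det y = 1 \<and> proj y \<in> proj ` W} = (\<Union>\<gamma>\<in>\<Gamma>. {y. det y = 1 \<and> \<gamma> ** y ** mat 1 \<in> W})"
    (is "?L = ?R")
  proof
    show "?L \<subseteq> ?R"
    proof
      fix y assume "y \<in> ?L"
      then obtain w where w: "w \<in> W" "det y = 1" "proj w = proj y"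
        by auto
      moreover have "det w = 1"
        using W w by auto
      ultimately obtain \<gamma> where "\<gamma> \<in> \<Gamma>" "w = \<gamma> ** y"
        using proj_eq_iff[of w y] by auto
      with w show "y \<in> ?R" by auto
    qed
    show "?R \<subseteq> ?L"
    proof
      fix y assume "y \<in> ?R"
      then obtain \<gamma> where y: "\<gamma> \<in> \<Gamma>" "det y = 1" "\<gamma> ** y \<in> W"
        by auto
      then have "proj (\<gamma> ** y) = proj y"
        using proj_eq_iff[of "\<gamma> ** y" y] by (auto simp: det_mul det_\<Gamma>)
      with y show "y \<in> ?L"
        by (metis (mono_tags, lifting) image_eqI mem_Collect_eq)
    qed
  qed
  moreover have "openin (top_of_set (carrier SL)) ?R"
    using openin_SL_mult_preimage[OF assms det_\<Gamma>, of _ "mat 1"] by (intro openin_Union) auto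
  moreover have "proj ` W \<subseteq> X"
    using W by (auto intro!: proj_in_X)
  ultimately show ?thesis
    by (simp add: openin_coset_topology_SL)
qed

section \<open>Borel sets and positivity of the invariant measure on open sets\<close>

lemma sets_subset_X: "A \<in> sets \<mu> \<Longrightarrow> A \<subseteq> X"
  using sets.sets_into_space space by metis

lemma openin_sets: "openin (coset_topology SL \<Gamma>) U \<Longrightarrow> U \<in> sets \<mu>"
  by (simp add: sets)

lemma translate_sets:
  assumes "A \<in> sets \<mu>" "det g = 1"
  shows "translate g A \<in> sets \<mu>"
proof -
  have "A \<in> sigma_sets X {U. openin (coset_topology SL \<Gamma>) U}"
    using assms sets by simp
  then show ?thesis
  proof induction
    case (Basic U)
    then show ?case using openin_translate assms openin_sets by auto
  next
    case Empty
    then show ?case by (simp add: translate_def)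
  next
    case (Compl A)
    then have "A \<subseteq> X"
      using sets sets_subset_X by auto
    \<comment> \<open>Being a bijection of \<open>X\<close>, translation commutes with
      complements.\<close>
    have "translate g X = X"
    proof
      show "X \<subseteq> translate g X"
      proof
        fix x assume "x \<in> X"
        then obtain y where "det y = 1" "x = proj y" by (rule X_cases)
        then show "x \<in> translate g X"
          using assms by (simp add: mem_translate_iff proj_in_X det_mul det_inv_SL)
      qed
    qed (use assms translate_subset in blast)
    then have "translate g (X - A) = X - translate g A"
      using translate_diff[of X A g] \<open>A \<subseteq> X\<close> assms by simp
    then show ?case
      using Compl space by (metis sets.compl_sets)
  next
    case (Union A)
    have "translate g (\<Union>i. A i) = (\<Union>i. translate g (A i))"
      by (auto simp: translate_def)
    then show ?case using Union by auto
  qed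
qed

lemma measure_translate:
  assumes "A \<in> sets \<mu>" "det g = 1"
  shows "measure \<mu> (translate g A) = measure \<mu> A"
  using invariant[OF assms(2,1)] by (simp add: measure_def translate_def)

lemma open_nonempty_cases:
  assumes "openin (coset_topology SL \<Gamma>) U" "U \<noteq> {}"
  obtains g where "det g = 1" "proj g \<in> U"
proof -
  obtain x where "x \<in> U" "x \<in> X"
    using assms by (auto simp: openin_coset_topology_SL)
  then show thesis
    using that X_cases by blast
qed

text \<open>If \<open>U\<close> were null, so would be all its translates. By transitivity they
  cover \<open>X\<close>, and countably many suffice, so the total measure would be zero.\<close>

lemma open_measure_pos:
  assumes "openin (coset_topology SL \<Gamma>) U" "U \<noteq> {}"
  shows "measure \<mu> U > 0"
proof (rule ccontr)
  assume "\<not> measure \<mu> U > 0"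
  then have null: "measure \<mu> (translate g U) = 0" if "det g = 1" for g
    using measure_translate[OF openin_sets[OF assms(1)] that] by (simp add: zero_less_measure_iff)
  \<comment> \<open>The cover is lifted to the group, a subspace of a Euclidean space, where the
    Lindelof property gives a countable subcover.\<close>
  define lift where "lift g = {y. det y = 1 \<and> proj y \<in> translate g U}" for g
  define \<F> where "\<F> = lift ` carrier SL"
  have "openin (top_of_set (carrier SL)) S" if "S \<in> \<F>" for S
    using that openin_translate[OF assms(1)] by (auto simp: \<F>_def lift_def openin_coset_topology_SL)
  then obtain \<F>' where \<F>': "\<F>' \<subseteq> \<F>" "countable \<F>'" "\<Union>\<F>' = \<Union>\<F>"
    using Lindelof_openin[of \<F> "carrier SL"] by blast
  then have "countable \<F>' \<and> \<F>' \<subseteq> lift ` carrier SL"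
    by (simp add: \<F>_def)
  from countable_subset_image[THEN iffD1, OF this]
  obtain C where C: "countable C" "C \<subseteq> carrier SL" "\<F>' = lift ` C"
    by (elim exE conjE)
  obtain z where z: "det z = 1" "proj z \<in> U"
    using assms by (rule open_nonempty_cases)
  have "X \<subseteq> (\<Union>g\<in>C. translate g U)"
  proof
    fix x assume "x \<in> X"
    then obtain y where y: "det y = 1" "x = proj y" by (rule X_cases)
    have "y = z ** (inv\<^bsub>SL\<^esub> z ** y)"
      using z by (simp add: matrix_mul_assoc inv_SL_mult)
    then have "x = proj z #>\<^bsub>SL\<^esub> (inv\<^bsub>SL\<^esub> z ** y)"
      using y z by (simp add: proj_mult det_mul det_inv_SL)
    then have "proj y \<in> translate (inv\<^bsub>SL\<^esub> z ** y) U"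
      using y z by (auto simp: translate_def)
    then have "y \<in> lift (inv\<^bsub>SL\<^esub> z ** y)"
      using y by (simp add: lift_def)
    then have "y \<in> \<Union>\<F>"
      using y z by (auto simp: \<F>_def det_mul det_inv_SL)
    then show "x \<in> (\<Union>g\<in>C. translate g U)"
      unfolding \<F>'(3)[symmetric] C(3) using y by (auto simp: lift_def)
  qed
  moreover have "(\<Union>g\<in>C. translate g U) \<in> null_sets \<mu>"
  proof (intro null_sets_UN' C(1) null_setsI)
    fix g assume "g \<in> C"
    then have "det g = 1" using C by auto
    then show "translate g U \<in> sets \<mu>" "emeasure \<mu> (translate g U) = 0"
      using null translate_sets[OF openin_sets[OF assms(1)]] by (auto simp: emeasure_eq_measure)
  qed
  ultimately have "emeasure \<mu> X = 0"
    using emeasure_mono[of X "\<Union>g\<in>C. translate g U" \<mu>] null_setsD1[of _ \<mu>] null_setsD2[of _ \<mu>]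
    by (metis le_zero_eq)
  then show False
    using nonzero space by simp
qed

section \<open>Invariance of sets up to null sets\<close>

lemma measure_diff_triangle:
  assumes "A \<in> sets \<mu>" "B \<in> sets \<mu>" "C \<in> sets \<mu>"
  shows "measure \<mu> (A - C) \<le> measure \<mu> (A - B) + measure \<mu> (B - C)"
proof -
  have "measure \<mu> (A - C) \<le> measure \<mu> ((A - B) \<union> (B - C))"
    using assms by (intro finite_measure_mono) auto
  also have "\<dots> \<le> measure \<mu> (A - B) + measure \<mu> (B - C)"
    using assms by (intro measure_Un_le) auto
  finally show ?thesis .
qed

lemma measure_translate_diff:
  assumes "A \<in> sets \<mu>" "B \<in> sets \<mu>" "det g = 1"
  shows "measure \<mu> (translate g A - translate g B) = measure \<mu> (A - B)"
  using measure_translate[of "A - B" g] assms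
  by (simp add: translate_diff[OF sets_subset_X[OF assms(1)] sets_subset_X[OF assms(2)] assms(3)])

text \<open>Half of the symmetric difference is enough: the two sets have the same finite measure,
  so the other half is null as well (\<open>stabilizer_flip\<close>).\<close>

definition stabilizer :: "(real^'n^'n) set set \<Rightarrow> (real^'n^'n) set" where
  "stabilizer E = {g. det g = 1 \<and> measure \<mu> (E - translate g E) = 0}"

lemma stabilizer_flip:
  assumes "E \<in> sets \<mu>" "g \<in> stabilizer E"
  shows "measure \<mu> (translate g E - E) = 0"
proof -
  have g: "det g = 1" "measure \<mu> (E - translate g E) = 0"
    using assms by (auto simp: stabilizer_def)
  have "measure \<mu> (translate g E - E) = measure \<mu> (E - translate g E)"
    using finite_measure_Diff'[of E "translate g E"] finite_measure_Diff'[of "translate g E" E]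
      measure_translate[OF assms(1) g(1)] translate_sets[OF assms(1) g(1)] assms(1)
    by (simp add: Int_commute)
  then show ?thesis using g by simp
qed

lemma stabilizer_mult:
  assumes "E \<in> sets \<mu>" "g \<in> stabilizer E" "h \<in> stabilizer E"
  shows "g ** h \<in> stabilizer E"
proof -
  have g: "det g = 1" "measure \<mu> (E - translate g E) = 0"
    and h: "det h = 1" "measure \<mu> (E - translate h E) = 0"
    using assms by (auto simp: stabilizer_def)
  note ts = translate_sets[OF assms(1) g(1)] translate_sets[OF assms(1) h(1)]
  have "measure \<mu> (E - translate (g ** h) E) \<le>
      measure \<mu> (E - translate h E) + measure \<mu> (translate h E - translate h (translate g E))"
    using translate_translate[OF sets_subset_X[OF assms(1)] g(1) h(1)]
    by (metis assms(1) h(1) measure_diff_triangle translate_sets ts(1) ts(2))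
  also have "\<dots> = 0"
    using measure_translate_diff[OF assms(1) ts(1) h(1)] g h by simp
  finally show ?thesis
    using g h by (simp add: stabilizer_def det_mul measure_le_0_iff)
qed

lemma stabilizer_inv:
  assumes "E \<in> sets \<mu>" "g \<in> stabilizer E"
  shows "inv\<^bsub>SL\<^esub> g \<in> stabilizer E"
proof -
  have g: "det g = 1"
    using assms by (auto simp: stabilizer_def)
  \<comment> \<open>Translating the null set of \<open>stabilizer_flip\<close> by the inverse of g
    turns it into the difference that is wanted.\<close>
  have "measure \<mu> (translate (inv\<^bsub>SL\<^esub> g) (translate g E) - translate (inv\<^bsub>SL\<^esub> g) E) = 0"
    using measure_translate_diff[OF translate_sets[OF assms(1) g] assms(1) det_inv_SL[OF g]]
      stabilizer_flip[OF assms] by simp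
  then show ?thesis
    using g sets_subset_X[OF assms(1)]
    by (simp add: stabilizer_def translate_translate det_inv_SL inv_SL_mult translate_one)
qed

text \<open>As E is open and \<open>c n\<close> tends to the identity, each point of E lies in all
  late translates. The tails \<open>B k\<close> thus decrease to the empty set, and continuity from
  above of the finite measure applies.\<close>

lemma measure_diff_translate_tendsto_0:
  assumes "openin (coset_topology SL \<Gamma>) E" "\<And>n. det (c n) = 1" "c \<longlonglongrightarrow> mat 1"
  shows "(\<lambda>n. measure \<mu> (E - translate (c n) E)) \<longlonglongrightarrow> 0"
proof -
  define B where "B k = (\<Union>n\<in>{k..}. E - translate (c n) E)" for k
  have E: "E \<in> sets \<mu>" "E \<subseteq> X"
    using openin_sets[OF assms(1)] sets_subset_X by auto
  have D: "E - translate (c n) E \<in> sets \<mu>" for n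
    using E translate_sets assms by auto
  then have B: "range B \<subseteq> sets \<mu>"
    unfolding B_def by (intro image_subsetI sets.countable_UN'') auto
  have "decseq B"
    by (force simp: B_def decseq_def)
  have empty: "(\<Inter>k. B k) = {}"
  proof (rule ccontr)
    assume "(\<Inter>k. B k) \<noteq> {}"
    then obtain x where x: "\<And>k. x \<in> B k" by auto
    then have "x \<in> E" by (auto simp: B_def)
    then obtain y where y: "det y = 1" "x = proj y"
      using E X_cases by blast
    have "(\<lambda>n. inv\<^bsub>SL\<^esub> (c n)) \<longlonglongrightarrow> inv\<^bsub>SL\<^esub> (mat 1)"
      using assms by (intro tendsto_inv_SL) auto
    then have "(\<lambda>n. inv\<^bsub>SL\<^esub> (c n)) \<longlonglongrightarrow> mat 1"
      using SL.inv_one by simp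
    then have "(\<lambda>n. y ** inv\<^bsub>SL\<^esub> (c n)) \<longlonglongrightarrow> y ** mat 1"
      by (intro tendsto_intros)
    then have "\<forall>\<^sub>F n in sequentially. y ** inv\<^bsub>SL\<^esub> (c n) \<in> {g. det g = 1 \<and> proj g \<in> E}"
      using assms(1) y \<open>x \<in> E\<close>
      by (intro openin_tendstoD[of "carrier SL"])
         (auto simp: openin_coset_topology_SL det_mul det_inv_SL assms(2))
    then obtain N where "\<And>n. n \<ge> N \<Longrightarrow> proj (y ** inv\<^bsub>SL\<^esub> (c n)) \<in> E"
      by (auto simp: eventually_sequentially)
    then have "x \<in> translate (c n) E" if "n \<ge> N" for n
      using that y E assms by (simp add: mem_translate_iff)
    then show False
      using x[of N] by (auto simp: B_def)
  qed
  have lim: "(\<lambda>k. measure \<mu> (B k)) \<longlonglongrightarrow> 0"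
    using finite_Lim_measure_decseq[OF B \<open>decseq B\<close>] empty by simp
  have "measure \<mu> (E - translate (c n) E) \<le> measure \<mu> (B n)" for n
    using B by (intro finite_measure_mono) (auto simp: B_def)
  then show ?thesis
    by (intro Lim_null_comparison[OF _ lim]) simp
qed

text \<open>Mautner phenomenon: conjugating \<open>u\<close> by elements that stabilize \<open>E\<close> almost everywhere does not
  change the measure of \<open>E - translate u E\<close>, while the conjugates tend to the identity.\<close>

lemma stabilizer_contracted:
  assumes E: "openin (coset_topology SL \<Gamma>) E" and u: "det u = 1"
    and a: "\<And>n. a n \<in> stabilizer E" and lim: "(\<lambda>n. inv\<^bsub>SL\<^esub> (a n) ** u ** a n) \<longlonglongrightarrow> mat 1"
  shows "u \<in> stabilizer E"
proof -
  define c where "c n = inv\<^bsub>SL\<^esub> (a n) ** u ** a n" for n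
  have det_a: "det (a n) = 1" for n
    using a by (auto simp: stabilizer_def)
  have sE: "E \<in> sets \<mu>" "E \<subseteq> X"
    using openin_sets[OF E] sets_subset_X by auto
  have "measure \<mu> (E - translate u E) \<le> measure \<mu> (E - translate (c n) E)" for n
  proof -
    let ?b = "inv\<^bsub>SL\<^esub> (a n)"
    have det_b: "det ?b = 1" by (rule det_inv_SL[OF det_a])
    note s = sE translate_sets det_a det_b u
    have c: "translate (c n) E = translate (a n) (translate u (translate ?b E))"
      using s by (simp add: c_def translate_translate translate_subset det_mul)
    \<comment> \<open>After translation by \<open>a n\<close>, two replacements lead to the
      conjugate \<open>c n\<close>: the translate of E by \<open>a n\<close> becomes E, and the
      innermost E becomes its translate by \<open>?b\<close>. Each costs only a null set.\<close>
    have "measure \<mu> (E - translate u E) = measure \<mu> (translate (a n) E - translate (a n) (translate u E))"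
      using s by (simp add: measure_translate_diff)
    also have "\<dots> \<le> measure \<mu> (translate (a n) E - E) +
        measure \<mu> (E - translate (a n) (translate u E))"
      using s by (intro measure_diff_triangle) auto
    also have "measure \<mu> (E - translate (a n) (translate u E)) \<le> measure \<mu> (E - translate (c n) E) +
        measure \<mu> (translate (c n) E - translate (a n) (translate u E))"
      unfolding c using s by (intro measure_diff_triangle) auto
    also have "measure \<mu> (translate (c n) E - translate (a n) (translate u E)) =
        measure \<mu> (translate ?b E - E)"
      unfolding c using s by (simp add: measure_translate_diff)
    also have "\<dots> = 0"
      using stabilizer_flip stabilizer_inv sE a by blast
    also have "measure \<mu> (translate (a n) E - E) = 0"
      using stabilizer_flip sE a by blast
    finally show ?thesis by simp
  qed
  moreover have "(\<lambda>n. measure \<mu> (E - translate (c n) E)) \<longlonglongrightarrow> 0"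
    using lim det_a u by (intro measure_diff_translate_tendsto_0 E) (auto simp: c_def det_mul det_inv_SL)
  ultimately have "measure \<mu> (E - translate u E) \<le> 0"
    by (intro LIMSEQ_le_const) auto
  then show ?thesis
    using u by (simp add: stabilizer_def measure_le_0_iff)
qed

text \<open>The transvections that avoid the index k are commutators of those that involve it, and
  transvections generate the whole group.\<close>

lemma stabilizer_full:
  fixes k :: 'n
  assumes E: "E \<in> sets \<mu>"
    and T: "\<And>i c. i \<noteq> k \<Longrightarrow> transvection i k c \<in> stabilizer E"
           "\<And>i c. i \<noteq> k \<Longrightarrow> transvection k i c \<in> stabilizer E"
    and g: "det g = 1"
  shows "g \<in> stabilizer E"
  using g
proof (rule SL_induct_transvection)
  show "mat 1 \<in> stabilizer E"
    using sets_subset_X[OF E] by (simp add: stabilizer_def translate_one)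
  fix i j :: 'n and c A assume "i \<noteq> j" "A \<in> stabilizer E"
  moreover have "transvection i j c \<in> stabilizer E"
  proof (cases "i = k \<or> j = k")
    case True
    then show ?thesis using T \<open>i \<noteq> j\<close> by auto
  next
    case False
    then have "transvection i k c ** (transvection k j 1 **
        (transvection i k (- c) ** transvection k j (- 1))) \<in> stabilizer E"
      using T by (intro stabilizer_mult E) auto
    then show ?thesis
      using transvection_commutator[of i k j c] False \<open>i \<noteq> j\<close> by auto
  qed
  ultimately show "transvection i j c ** A \<in> stabilizer E"
    using stabilizer_mult E by blast
qed

text \<open>By transitivity some translate of E meets V in a nonempty open set, which has positive
  measure. If E missed V, that set would lie in the null set
  \<open>translate g E - E\<close>.\<close>

lemma open_meets_if_stabilizer_full:
  assumes E: "openin (coset_topology SL \<Gamma>) E" "E \<noteq> {}"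
    and V: "openin (coset_topology SL \<Gamma>) V" "V \<noteq> {}"
    and full: "\<And>g. det g = 1 \<Longrightarrow> g \<in> stabilizer E"
  shows "E \<inter> V \<noteq> {}"
proof
  assume disj: "E \<inter> V = {}"
  obtain e where e: "det e = 1" "proj e \<in> E"
    using E by (rule open_nonempty_cases)
  obtain v where v: "det v = 1" "proj v \<in> V"
    using V by (rule open_nonempty_cases)
  define g where "g = inv\<^bsub>SL\<^esub> e ** v"
  have g: "det g = 1" "e ** g = v"
    using e v by (auto simp: g_def det_mul det_inv_SL matrix_mul_assoc inv_SL_mult)
  then have "proj v = proj e #>\<^bsub>SL\<^esub> g"
    using e by (simp add: proj_mult)
  then have "translate g E \<inter> V \<noteq> {}"
    using e v by (auto simp: translate_def)
  then have "0 < measure \<mu> (translate g E \<inter> V)"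
    using E V g by (intro open_measure_pos openin_Int openin_translate) auto
  also have "\<dots> \<le> measure \<mu> (translate g E - E)"
    using disj E g openin_sets translate_sets by (intro finite_measure_mono) auto
  also have "\<dots> = 0"
    using stabilizer_flip full E g openin_sets by blast
  finally show False by simp
qed

text \<open>Here \<open>d n\<close> is the n-th power of \<open>a\<close>. Only exponents n \<ge> 0
  are allowed: negative powers of the flow would expand the directions that
  \<open>flow_conj_tendsto_one\<close> has to keep bounded.\<close>

lemma forward_orbit_meets_open:
  fixes d :: "nat \<Rightarrow> real^'n^'n" and k :: 'n
  assumes a: "det a = 1" and d: "d 0 = mat 1" "\<And>n. d (Suc n) = d n ** a"
    and contr: "\<And>i c. i \<noteq> k \<Longrightarrow> (\<lambda>n. inv\<^bsub>SL\<^esub> (d n) ** transvection i k c ** d n) \<longlonglongrightarrow> mat 1"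
    and expand: "\<And>i c. i \<noteq> k \<Longrightarrow> (\<lambda>n. d n ** transvection k i c ** inv\<^bsub>SL\<^esub> (d n)) \<longlonglongrightarrow> mat 1"
    and W: "openin (coset_topology SL \<Gamma>) W" "W \<noteq> {}"
    and V: "openin (coset_topology SL \<Gamma>) V" "V \<noteq> {}"
  shows "\<exists>n. translate (d n) W \<inter> V \<noteq> {}"
proof -
  have det_d: "det (d n) = 1" for n
    by (induction n) (auto simp: d a det_mul)
  have WX: "W \<subseteq> X" using W by (simp add: openin_coset_topology_SL)
  define E where "E = (\<Union>n. translate (d n) W)"
  have E: "openin (coset_topology SL \<Gamma>) E"
    unfolding E_def using W det_d by (intro openin_Union) (auto intro!: openin_translate)
  then have sE: "E \<in> sets \<mu>"
    by (rule openin_sets)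
  have "W \<subseteq> E"
    using translate_one[OF WX] d(1) unfolding E_def by (metis UN_upper UNIV_I)
  have "translate a E \<subseteq> E"
  proof -
    have "translate a E = (\<Union>n. translate a (translate (d n) W))"
      by (auto simp: E_def translate_def)
    also have "\<dots> = (\<Union>n. translate (d (Suc n)) W)"
      using WX by (simp add: translate_translate det_d a d)
    finally show ?thesis
      by (auto simp: E_def)
  qed
  \<comment> \<open>The translate lies inside E and has the same finite measure, so the difference
    is null.\<close>
  then have a_in: "a \<in> stabilizer E"
    using a sE translate_sets[OF sE a] measure_translate[OF sE a]
    by (simp add: stabilizer_def finite_measure_Diff)
  have d_in: "d n \<in> stabilizer E" for n
  proof (induction n)
    case 0
    then show ?case
      using sets_subset_X[OF sE] by (simp add: d stabilizer_def translate_one)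
  next
    case (Suc n)
    then show ?case using stabilizer_mult[OF sE] a_in d by simp
  qed
  have "E \<inter> V \<noteq> {}"
  proof (rule open_meets_if_stabilizer_full[OF E _ V])
    show "E \<noteq> {}" using \<open>W \<subseteq> E\<close> W by auto
    show "g \<in> stabilizer E" if "det g = 1" for g
    proof (rule stabilizer_full[OF sE _ _ that])
      fix i c assume i: "i \<noteq> k"
      show "transvection i k c \<in> stabilizer E"
        using i by (intro stabilizer_contracted[OF E _ d_in contr]) (auto simp: det_transvection)
      have "inv\<^bsub>SL\<^esub> (inv\<^bsub>SL\<^esub> (d n)) = d n" for n
        using SL.inv_inv[of "d n"] det_d by simp
      \<comment> \<open>What conjugation by \<open>d n\<close> expands, conjugation by its inverse
        contracts, and the inverses stabilize E too.\<close>
      then show "transvection k i c \<in> stabilizer E"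
        using stabilizer_contracted[OF E _ stabilizer_inv[OF sE d_in], of "transvection k i c" id]
          expand[OF i, of c] i by (simp add: det_transvection)
    qed
  qed
  then show ?thesis by (auto simp: E_def)
qed

end

lemma lattice_in_SL_imp_homogeneous_space:
  fixes \<Gamma> :: "(real^'n^'n) set"
  assumes "lattice_in SL \<Gamma>"
  obtains \<mu> where "SL_homogeneous_space \<Gamma> \<mu>"
proof -
  obtain \<mu> where \<mu>: "space \<mu> = rcosets\<^bsub>SL\<^esub> \<Gamma>"
      "sets \<mu> = sigma_sets (rcosets\<^bsub>SL\<^esub> \<Gamma>) {U. openin (coset_topology SL \<Gamma>) U}"
      "finite_measure \<mu>" "emeasure \<mu> (space \<mu>) \<noteq> 0"
    and inv: "\<forall>g\<in>carrier SL. \<forall>A\<in>sets \<mu>. emeasure \<mu> ((\<lambda>x. x #>\<^bsub>SL\<^esub> g) ` A) = emeasure \<mu> A"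
    using assms unfolding lattice_in_def finite_covolume_def by blast
  have "SL_homogeneous_space \<Gamma> \<mu>"
  proof (rule SL_homogeneous_space.intro)
    show "emeasure \<mu> ((\<lambda>x. x #>\<^bsub>SL\<^esub> g) ` A) = emeasure \<mu> A" if "det g = 1" "A \<in> sets \<mu>" for g A
      using bspec[OF bspec[OF inv] that(2)] that(1) by simp
  qed (use assms in \<open>simp add: lattice_in_def\<close>, (fact \<mu>)+)
  then show thesis by (rule that)
qed

section \<open>The diagonal flow\<close>

definition diagonal :: "('n \<Rightarrow> real) \<Rightarrow> real^'n^'n" where
  "diagonal e = (\<chi> i j. if i = j then e i else 0)"

lemma diagonal_mult_nth:
  fixes A :: "real^'n^'n"
  shows "(diagonal e ** A) $ i $ j = e i * A $ i $ j" "(A ** diagonal e) $ i $ j = A $ i $ j * e j"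
proof -
  have "(diagonal e ** A) $ i $ j = (\<Sum>k\<in>UNIV. if i = k then e i * A $ k $ j else 0)"
    unfolding matrix_matrix_mult_def diagonal_def vec_lambda_beta by (rule sum.cong) auto
  then show "(diagonal e ** A) $ i $ j = e i * A $ i $ j" by simp
  have "(A ** diagonal e) $ i $ j = (\<Sum>k\<in>UNIV. if k = j then A $ i $ k * e j else 0)"
    unfolding matrix_matrix_mult_def diagonal_def vec_lambda_beta by (rule sum.cong) auto
  then show "(A ** diagonal e) $ i $ j = A $ i $ j * e j" by simp
qed

lemma diagonal_mult: "diagonal e ** diagonal f = diagonal (\<lambda>i. e i * f i)"
  unfolding vec_eq_iff diagonal_mult_nth(1) by (simp add: diagonal_def)

lemma det_diagonal_eq: "det (diagonal e :: real^'n^'n) = prod e UNIV"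
  by (subst det_diagonal) (auto simp: diagonal_def)

lemma inv_SL_diagonal:
  assumes "prod e UNIV = 1"
  shows "inv\<^bsub>SL\<^esub> (diagonal e :: real^'n^'n) = diagonal (\<lambda>i. inverse (e i))"
proof -
  have "e i \<noteq> 0" for i
    using assms prod_zero[of UNIV e] by auto
  then have "diagonal (\<lambda>i. inverse (e i)) ** diagonal e = (mat 1 :: real^'n^'n)"
    by (simp add: diagonal_mult) (simp add: diagonal_def mat_def)
  moreover have "det (diagonal (\<lambda>i. inverse (e i)) :: real^'n^'n) = 1"
    using assms by (simp add: det_diagonal_eq prod_inversef[unfolded comp_def])
  ultimately show ?thesis
    using assms by (intro group.inv_equality[OF group_SL]) (auto simp: det_diagonal_eq)
qed

lemma transvection_tendsto_one:
  assumes "f \<longlonglongrightarrow> 0"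
  shows "(\<lambda>n. transvection i j (f n) :: real^'n^'n) \<longlonglongrightarrow> mat 1"
proof -
  have "(\<lambda>n. transvection i j (f n) $ k $ l) \<longlonglongrightarrow> (mat 1 :: real^'n^'n) $ k $ l" for k l
    using tendsto_add[OF tendsto_const assms, of "(mat 1 :: real^'n^'n) $ k $ l"]
    by (cases "k = i \<and> l = j") (auto simp: transvection_def)
  then show ?thesis
    by (intro vec_tendstoI) auto
qed

lemma tendsto_block_lower [tendsto_intros]:
  fixes v :: "'a \<Rightarrow> real^'m"
  assumes "(A \<longlongrightarrow> A') F" "(v \<longlongrightarrow> v') F" "(d \<longlongrightarrow> d') F"
  shows "((\<lambda>x. block_lower (A x) (v x) (d x)) \<longlongrightarrow> block_lower A' v' d') F"
proof -
  have "((\<lambda>x. block_lower (A x) (v x) (d x) $ i $ j) \<longlongrightarrow> block_lower A' v' d' $ i $ j) F" for i j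
    by (cases i; cases j) (auto intro!: tendsto_intros assms)
  then show ?thesis
    by (intro vec_tendstoI) auto
qed

text \<open>The powers of \<open>diag(s, \<dots>, s, 1/2)\<close> with \<open>s ^ m = 2\<close>.\<close>

definition flow_entry :: "nat \<Rightarrow> 'm::finite option \<Rightarrow> real" where
  "flow_entry n i = (case i of None \<Rightarrow> 1 / 2 | Some (_::'m) \<Rightarrow> 2 powr (1 / real CARD('m))) ^ n"

abbreviation flow :: "nat \<Rightarrow> real^('m::finite option)^('m option)" where
  "flow n \<equiv> diagonal (flow_entry n)"

lemma flow_entry_pos: "flow_entry n i > 0"
  by (auto simp: flow_entry_def split: option.split)

lemma prod_flow_entry: "(\<Prod>i\<in>UNIV. flow_entry n (i :: 'm::finite option)) = 1"
proof -
  have "(2 powr (1 / real CARD('m))) ^ CARD('m) = (2 powr (1 / real CARD('m))) powr real CARD('m)"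
    by (simp add: powr_realpow)
  also have "\<dots> = 2"
    unfolding powr_powr by simp
  finally have "(2 powr (1 / real CARD('m))) ^ CARD('m) = 2" .
  then have "(\<Prod>i\<in>UNIV. flow_entry 1 (i :: 'm option)) = 1"
    by (simp add: prod_UNIV_option flow_entry_def)
  moreover have "flow_entry n i = flow_entry 1 i ^ n" for i :: "'m option"
    by (simp add: flow_entry_def)
  ultimately show ?thesis
    by (simp flip: prod_power_distrib)
qed

lemma det_flow: "det (flow n :: real^('m option)^('m::finite option)) = 1"
  by (simp add: det_diagonal_eq prod_flow_entry)

lemma inv_flow: "inv\<^bsub>SL\<^esub> (flow n :: real^('m option)^('m::finite option)) =
    diagonal (\<lambda>i. inverse (flow_entry n i))"
  by (simp add: inv_SL_diagonal prod_flow_entry)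

text \<open>Passing from p to \<open>inv (flow n) ** p ** flow n\<close> multiplies the entry of p
  at \<open>(Some a, None)\<close> by this ratio and the entry at \<open>(None, Some a)\<close> by
  its reciprocal.\<close>

lemma flow_entry_ratio_le:
  "flow_entry n (None :: 'm::finite option) / flow_entry n (Some a :: 'm option) \<le> (1 / 2) ^ n"
proof -
  have "1 \<le> (2 powr (1 / real CARD('m))) ^ n"
    by (rule one_le_power) (simp add: ge_one_powr_ge_zero)
  then have "(1 / 2) ^ n / (2 powr (1 / real CARD('m))) ^ n \<le> (1 / 2 :: real) ^ n / 1"
    by (intro divide_left_mono) auto
  then show ?thesis
    by (simp add: flow_entry_def)
qed

lemma flow_entry_ratio_le_1:
  "flow_entry n (None :: 'm::finite option) / flow_entry n (Some a :: 'm option) \<le> 1"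
  using flow_entry_ratio_le[of n a] power_le_one[of "1 / 2 :: real" n] by simp

lemma flow_entry_ratio_tendsto_0:
  "(\<lambda>n. flow_entry n (None :: 'm::finite option) / flow_entry n (Some a :: 'm option)) \<longlonglongrightarrow> 0"
proof (rule Lim_null_comparison)
  have "norm (flow_entry n (None :: 'm option) / flow_entry n (Some a)) \<le> (1 / 2) ^ n" for n
    using flow_entry_ratio_le[of n a] flow_entry_pos[of n "None :: 'm option"]
      flow_entry_pos[of n "Some a"] by (simp add: abs_of_pos)
  then show "\<forall>\<^sub>F n in sequentially.
      norm (flow_entry n (None :: 'm option) / flow_entry n (Some a)) \<le> (1 / 2) ^ n"
    by (intro always_eventually allI)
  show "(\<lambda>n. (1 / 2) ^ n) \<longlonglongrightarrow> (0 :: real)"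
    by (rule LIMSEQ_power_zero) simp
qed

lemma flow_contracts:
  fixes i :: "'m::finite option"
  assumes "i \<noteq> None"
  shows "(\<lambda>n. inv\<^bsub>SL\<^esub> (flow n) ** transvection i None c ** flow n) \<longlonglongrightarrow> mat 1"
proof -
  obtain a where i: "i = Some a" using assms by auto
  have nz: "flow_entry n j \<noteq> 0" for n and j :: "'m option"
    using flow_entry_pos[of n j] by simp
  have "inv\<^bsub>SL\<^esub> (flow n) ** transvection i None c ** flow n =
      transvection i None (c * (flow_entry n (None :: 'm option) / flow_entry n i))" for n
    using nz i by (auto simp: inv_flow vec_eq_iff diagonal_mult_nth)
      (auto simp: transvection_def mat_def field_simps)
  then show ?thesis
    using tendsto_mult_right_zero[OF flow_entry_ratio_tendsto_0[of a], of c] i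
    by (simp add: transvection_tendsto_one)
qed

lemma flow_expands:
  fixes i :: "'m::finite option"
  assumes "i \<noteq> None"
  shows "(\<lambda>n. flow n ** transvection None i c ** inv\<^bsub>SL\<^esub> (flow n)) \<longlonglongrightarrow> mat 1"
proof -
  obtain a where i: "i = Some a" using assms by auto
  have nz: "flow_entry n j \<noteq> 0" for n and j :: "'m option"
    using flow_entry_pos[of n j] by simp
  have "flow n ** transvection None i c ** inv\<^bsub>SL\<^esub> (flow n) =
      transvection None i (c * (flow_entry n (None :: 'm option) / flow_entry n i))" for n
    using nz i by (auto simp: inv_flow vec_eq_iff diagonal_mult_nth)
      (auto simp: transvection_def mat_def field_simps)
  then show ?thesis
    using tendsto_mult_right_zero[OF flow_entry_ratio_tendsto_0[of a], of c] i
    by (simp add: transvection_tendsto_one)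
qed

lemma flow_eq_block_lower:
  "(flow n :: real^('m::finite option)^('m option)) =
     block_lower ((2 powr (1 / real CARD('m))) ^ n *\<^sub>R mat 1) 0 ((1 / 2) ^ n)"
proof -
  have "(flow n :: real^('m option)^('m option)) $ i $ j =
     block_lower ((2 powr (1 / real CARD('m))) ^ n *\<^sub>R mat 1) 0 ((1 / 2) ^ n) $ i $ j" for i j
    by (cases i; cases j) (auto simp: diagonal_def flow_entry_def mat_def)
  then show ?thesis by (simp add: vec_eq_iff)
qed

text \<open>Take q = 1 and t = 2^(-n): then t^(-1/m) = 2^(n/m) is exactly the corner entry of the
  flow.\<close>

lemma block_lower_flow_in_H_group:
  fixes v :: "real^'m"
  assumes "mat 1 \<in> \<Delta>"
  shows "block_lower (mat 1) v 1 ** flow n \<in> H_group \<Delta>"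
proof -
  have "((1 / 2) ^ n) powr (- 1 / real CARD('m)) = (2 powr (1 / real CARD('m))) ^ n"
    by (simp add: powr_def ln_realpow ln_div flip: exp_of_nat_mult)
  moreover have "block_lower (mat 1) v 1 ** flow n =
      block_lower ((2 powr (1 / real CARD('m))) ^ n *\<^sub>R mat 1)
        (v v* ((2 powr (1 / real CARD('m))) ^ n *\<^sub>R mat 1)) ((1 / 2) ^ n)"
    by (simp add: flow_eq_block_lower block_lower_mult)
  ultimately show ?thesis
    using assms unfolding H_group_def
    by (auto intro!: exI[of _ "(1 / 2) ^ n"] exI[of _ "mat 1"])
qed

section \<open>Density of the orbits\<close>

definition corner :: "real^('m::finite option)^('m option) \<Rightarrow> real^'m^'m" where
  "corner b = (\<chi> i j. b $ Some i $ Some j)"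

definition last_row :: "real^('m::finite option)^('m option) \<Rightarrow> real^'m" where
  "last_row b = (\<chi> j. b $ None $ Some j)"

text \<open>This is the lower factor u of a block factorization b = u p. Its row w solves w A = r,
  where A is the corner and r the last row of b, so p has zeros in the last row left of the
  diagonal. The corner is invertible for b near the identity.\<close>

definition unipotent_part :: "real^('m::finite option)^('m option) \<Rightarrow> real^('m option)^('m option)" where
  "unipotent_part b = block_lower (mat 1) (last_row b v* cramer_inverse (corner b)) 1"

lemma det_unipotent_part: "det (unipotent_part b) = 1"
  by (simp add: unipotent_part_def det_block_lower)

lemma unipotent_part_mult_nth_None:
  fixes b :: "real^('m::finite option)^('m option)"
  assumes "det (corner b) \<noteq> 0"
  shows "(inv\<^bsub>SL\<^esub> (unipotent_part b) ** b) $ None $ Some j = 0"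
proof -
  define w where "w = last_row b v* cramer_inverse (corner b)"
  have "block_lower (mat 1) (- w) 1 ** block_lower (mat 1) w 1 = mat 1"
    by (simp add: block_lower_mult block_lower_one)
  then have inv: "inv\<^bsub>SL\<^esub> (unipotent_part b) = block_lower (mat 1) (- w) 1"
    by (intro group.inv_equality[OF group_SL])
       (simp_all add: unipotent_part_def w_def det_block_lower)
  have "w v* corner b = last_row b"
    using matrix_mul_cramer_inverse(2)[OF assms] by (simp add: w_def vector_matrix_mul_assoc)
  then have "(\<Sum>i\<in>UNIV. w $ i * b $ Some i $ Some j) = b $ None $ Some j"
    by (simp add: vec_eq_iff vector_matrix_mult_def corner_def last_row_def mult.commute)
  then show ?thesis
    unfolding inv by (simp add: matrix_matrix_mult_def sum_UNIV_option sum_negf)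
qed

lemma corner_mat_1: "corner (mat 1) = mat 1" and last_row_mat_1: "last_row (mat 1) = 0"
  by (simp_all add: corner_def last_row_def vec_eq_iff mat_def)

lemma tendsto_corner: "(f \<longlongrightarrow> A) F \<Longrightarrow> ((\<lambda>x. corner (f x)) \<longlongrightarrow> corner A) F"
  unfolding corner_def by (intro tendsto_vec_lambda tendsto_vec_nth)

lemma unipotent_part_tendsto_one:
  assumes "(b \<longlongrightarrow> mat 1) F"
  shows "((\<lambda>x. unipotent_part (b x)) \<longlongrightarrow> mat 1) F"
proof -
  have "((\<lambda>x. last_row (b x)) \<longlongrightarrow> last_row (mat 1)) F"
    unfolding last_row_def by (intro tendsto_intros assms)
  moreover have "((\<lambda>x. cramer_inverse (corner (b x))) \<longlongrightarrow> cramer_inverse (corner (mat 1))) F"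
    by (intro tendsto_cramer_inverse tendsto_corner assms) (simp add: corner_mat_1)
  ultimately have "((\<lambda>x. unipotent_part (b x)) \<longlongrightarrow>
      block_lower (mat 1) (last_row (mat 1) v* cramer_inverse (corner (mat 1))) 1) F"
    unfolding unipotent_part_def by (intro tendsto_intros)
  then show ?thesis
    by (simp add: last_row_mat_1 block_lower_one)
qed

text \<open>The exponents \<open>n k\<close> are arbitrary, since recurrence gives no control over
  them. Conjugation fixes the corner and the last diagonal entry and does not enlarge the last
  column; the entries that it expands are zero by assumption.\<close>

lemma flow_conj_tendsto_one:
  fixes p :: "nat \<Rightarrow> real^('m::finite option)^('m option)"
  assumes "p \<longlonglongrightarrow> mat 1"
    and "\<forall>\<^sub>F k in sequentially. \<forall>j. p k $ None $ Some j = 0"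
  shows "(\<lambda>k. inv\<^bsub>SL\<^esub> (flow (n k)) ** p k ** flow (n k)) \<longlonglongrightarrow> mat 1"
proof -
  define q where "q k = inv\<^bsub>SL\<^esub> (flow (n k)) ** p k ** flow (n k)" for k
  have nz: "flow_entry n j \<noteq> 0" for n and j :: "'m option"
    using flow_entry_pos[of n j] by simp
  have q: "q k $ i $ j = p k $ i $ j * (flow_entry (n k) j / flow_entry (n k) i)" for k i j
    by (simp add: q_def inv_flow diagonal_mult_nth divide_inverse mult_ac)
  have p: "(\<lambda>k. p k $ i $ j) \<longlonglongrightarrow> mat 1 $ i $ j" for i j
    by (intro tendsto_intros assms)
  have same: "flow_entry m (Some a :: 'm option) = flow_entry m (Some b :: 'm option)" for m a b
    by (simp add: flow_entry_def)
  have "(\<lambda>k. q k $ i $ j) \<longlonglongrightarrow> mat 1 $ i $ j" for i j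
  proof (cases i)
    case None
    show ?thesis
    proof (cases j)
      case None
      with \<open>i = None\<close> show ?thesis using p[of None None] nz by (simp add: q)
    next
      case (Some b)
      have "\<forall>\<^sub>F k in sequentially. q k $ None $ Some b = 0"
        using assms(2) by eventually_elim (simp add: q)
      then show ?thesis
        using \<open>i = None\<close> Some by (simp add: tendsto_eventually mat_def)
    qed
  next
    case (Some a)
    show ?thesis
    proof (cases j)
      case None
      have "norm (q k $ Some a $ None) \<le> norm (p k $ Some a $ None)" for k
        using mult_left_mono[OF flow_entry_ratio_le_1[of "n k" a], of "\<bar>p k $ Some a $ None\<bar>"]
          by (simp add: q abs_mult abs_of_pos[OF flow_entry_pos])
      moreover have "(\<lambda>k. p k $ Some a $ None) \<longlonglongrightarrow> 0"
        using p[of "Some a" None] by (simp add: mat_def)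
      then have lim: "(\<lambda>k. norm (p k $ Some a $ None)) \<longlonglongrightarrow> 0"
        by (rule tendsto_norm_zero)
      ultimately have "(\<lambda>k. q k $ Some a $ None) \<longlonglongrightarrow> 0"
        by (intro Lim_null_comparison[OF _ lim]) simp
      then show ?thesis
        using Some None by (simp add: mat_def)
    next
      case (Some b)
      then show ?thesis
        using p[of i j] nz \<open>i = Some a\<close> same[of _ a b] by (simp add: q)
    qed
  qed
  then show ?thesis
    unfolding q_def[symmetric] by (intro vec_tendstoI)
qed

lemma tendsto_if_dist_less_inverse_Suc:
  assumes "\<And>k. dist (f k) l < 1 / Suc k"
  shows "f \<longlonglongrightarrow> l"
proof -
  have "norm (dist (f k) l) \<le> inverse (real (Suc k))" for k
    using assms[of k] by (simp add: inverse_eq_divide)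
  then have "(\<lambda>k. dist (f k) l) \<longlonglongrightarrow> 0"
    by (intro Lim_null_comparison[OF _ LIMSEQ_inverse_real_of_nat] always_eventually allI)
  then show ?thesis
    by (simp add: tendsto_dist_iff[of f])
qed

text \<open>Margulis' thickening argument: the open box around \<open>g\<close> supplied by recurrence is replaced by
  its slice along the unipotent group that the flow expands, because the flow does not expand the
  complementary directions.\<close>

lemma lattice_orbit_approx:
  fixes \<Gamma> :: "(real^('m::finite option)^('m option)) set"
  assumes lat: "lattice_in SL \<Gamma>" and \<Delta>: "mat 1 \<in> \<Delta>" and g: "det g = 1" and v: "det v = 1"
  obtains \<gamma> h where "range \<gamma> \<subseteq> \<Gamma>" "range h \<subseteq> H_group \<Delta>" "(\<lambda>k. \<gamma> k ** g ** h k) \<longlonglongrightarrow> v"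
proof -
  obtain \<mu> where "SL_homogeneous_space \<Gamma> \<mu>"
    using lattice_in_SL_imp_homogeneous_space[OF lat] .
  then interpret SL_homogeneous_space \<Gamma> \<mu> .
  have "\<exists>\<gamma> b n. \<gamma> \<in> \<Gamma> \<and> det b = 1 \<and> dist b (mat 1) < 1 / Suc k \<and>
      dist (\<gamma> ** g ** b ** flow n) v < 1 / Suc k" for k
  proof -
    \<comment> \<open>\<open>W\<close> is g times a small ball around the identity; the factor
      \<open>mat 1\<close> fits the two-sided form of \<open>openin_SL_mult_preimage\<close>. The
      displacement b will be g^(-1) y for a point y of \<open>W\<close>.\<close>
    define W where "W = {y. det y = 1 \<and> inv\<^bsub>SL\<^esub> g ** y ** mat 1 \<in> carrier SL \<inter> ball (mat 1) (1 / Suc k)}"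
    define V where "V = carrier SL \<inter> ball v (1 / Suc k)"
    have W: "openin (top_of_set (carrier SL)) W"
      unfolding W_def by (intro openin_SL_mult_preimage openin_open_Int) (auto simp: g det_inv_SL)
    have V: "openin (top_of_set (carrier SL)) V"
      unfolding V_def by (intro openin_open_Int) auto
    have "g \<in> W" "v \<in> V"
      using g v by (auto simp: W_def V_def inv_SL_mult)
    \<comment> \<open>With \<open>None\<close> as distinguished index, the transvections required
      are those of the last column, which the flow contracts, and of the last row, which it
      expands.\<close>
    then have "\<exists>n. translate (flow n) (proj ` W) \<inter> proj ` V \<noteq> {}"
    proof (intro forward_orbit_meets_open[where a = "flow 1" and k = None])
      show "flow 0 = mat 1"
        by (simp add: diagonal_def flow_entry_def mat_def vec_eq_iff)
      show "flow (Suc n) = flow n ** flow 1" for n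
        by (simp add: diagonal_mult) (simp add: diagonal_def flow_entry_def vec_eq_iff)
    qed (rule det_flow flow_contracts flow_expands openin_proj_image W V | assumption | blast)+
    then obtain n x where "x \<in> translate (flow n) (proj ` W)" "x \<in> proj ` V"
      by blast
    then obtain y z where y: "y \<in> W" and z: "z \<in> V" "proj z = proj y #>\<^bsub>SL\<^esub> flow n"
      unfolding translate_def by blast
    have "det y = 1" "det z = 1"
      using y z by (auto simp: W_def V_def)
    then have "proj z = proj (y ** flow n)"
      using z by (simp add: proj_mult det_flow)
    then obtain \<gamma> where \<gamma>: "\<gamma> \<in> \<Gamma>" "z = \<gamma> ** (y ** flow n)"
      using proj_eq_iff[of z "y ** flow n"] \<open>det y = 1\<close> \<open>det z = 1\<close> by (auto simp: det_mul det_flow)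
    have "g ** (inv\<^bsub>SL\<^esub> g ** y) = y"
      using g by (simp add: matrix_mul_assoc inv_SL_mult)
    then have "\<gamma> ** g ** (inv\<^bsub>SL\<^esub> g ** y) ** flow n = z"
      using \<gamma> by (simp flip: matrix_mul_assoc)
    then show ?thesis
      using \<gamma> y z g by (intro exI[of _ \<gamma>] exI[of _ "inv\<^bsub>SL\<^esub> g ** y"] exI[of _ n])
        (auto simp: W_def V_def dist_commute)
  qed
  then have "\<forall>k. \<exists>\<gamma> b n. \<gamma> \<in> \<Gamma> \<and> det b = 1 \<and> dist b (mat 1) < 1 / Suc k \<and>
      dist (\<gamma> ** g ** b ** flow n) v < 1 / Suc k"
    by (rule allI)
  then obtain \<gamma> b n where *: "\<forall>k. \<gamma> k \<in> \<Gamma> \<and> det (b k) = 1 \<and> dist (b k) (mat 1) < 1 / Suc k \<and>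
      dist (\<gamma> k ** g ** b k ** flow (n k)) v < 1 / Suc k"
    unfolding choice_iff by (elim exE)
  then have \<gamma>: "\<gamma> k \<in> \<Gamma>" and b: "det (b k) = 1" "dist (b k) (mat 1) < 1 / Suc k"
      and near: "dist (\<gamma> k ** g ** b k ** flow (n k)) v < 1 / Suc k" for k
    by blast+
  have lim_1: "b \<longlonglongrightarrow> mat 1"
    by (rule tendsto_if_dist_less_inverse_Suc[OF b(2)])
  have lim_v: "(\<lambda>k. \<gamma> k ** g ** b k ** flow (n k)) \<longlonglongrightarrow> v"
    by (rule tendsto_if_dist_less_inverse_Suc[OF near])
  \<comment> \<open>Write b = u p and move p across the flow: b a^n = u a^n q, where q is the
    conjugate of p by a^n. Since q tends to the identity whatever the exponents are, cancelling it
    on the right keeps the limit and leaves the factor u a^n, which lies in H.\<close>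
  define u where "u k = unipotent_part (b k)" for k
  define p where "p k = inv\<^bsub>SL\<^esub> (u k) ** b k" for k
  define q where "q k = inv\<^bsub>SL\<^esub> (flow (n k)) ** p k ** flow (n k)" for k
  have det_u: "det (u k) = 1" for k
    by (simp add: u_def det_unipotent_part)
  have one: "inv\<^bsub>SL\<^esub> (mat 1) = (mat 1 :: real^('m option)^('m option))"
    using SL.inv_one by simp
  have "u \<longlonglongrightarrow> mat 1"
    unfolding u_def by (rule unipotent_part_tendsto_one[OF lim_1])
  then have "(\<lambda>k. inv\<^bsub>SL\<^esub> (u k)) \<longlonglongrightarrow> mat 1"
    using tendsto_inv_SL[of u "mat 1"] det_u one by simp
  then have "p \<longlonglongrightarrow> mat 1 ** mat 1"
    unfolding p_def by (intro tendsto_intros lim_1)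
  \<comment> \<open>The corner of \<open>b k\<close> may be singular for small k, so this can only
    be claimed eventually.\<close>
  moreover have "\<forall>\<^sub>F k in sequentially. \<forall>j. p k $ None $ Some j = 0"
  proof -
    have "(\<lambda>k. det (corner (b k))) \<longlonglongrightarrow> det (corner (mat 1 :: real^('m option)^('m option)))"
      by (intro tendsto_intros tendsto_corner lim_1)
    then have "\<forall>\<^sub>F k in sequentially. det (corner (b k)) \<noteq> 0"
      by (rule tendsto_imp_eventually_ne) (simp add: corner_mat_1)
    then show ?thesis
      unfolding p_def u_def by (rule eventually_mono) (blast intro: unipotent_part_mult_nth_None)
  qed
  ultimately have "q \<longlonglongrightarrow> mat 1"
    unfolding q_def by (intro flow_conj_tendsto_one) auto
  moreover have det_q: "det (q k) = 1" for k
    by (simp add: q_def p_def det_mul det_inv_SL det_flow det_u b)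
  ultimately have "(\<lambda>k. inv\<^bsub>SL\<^esub> (q k)) \<longlonglongrightarrow> mat 1"
    using tendsto_inv_SL[of q "mat 1"] one by simp
  then have "(\<lambda>k. (\<gamma> k ** g ** b k ** flow (n k)) ** inv\<^bsub>SL\<^esub> (q k)) \<longlonglongrightarrow> v ** mat 1"
    by (intro tendsto_intros lim_v)
  moreover have "(\<gamma> k ** g ** b k ** flow (n k)) ** inv\<^bsub>SL\<^esub> (q k) = \<gamma> k ** g ** (u k ** flow (n k))" for k
  proof -
    have "u k ** (flow (n k) ** q k) = u k ** (flow (n k) ** inv\<^bsub>SL\<^esub> (flow (n k))) ** p k ** flow (n k)"
      by (simp add: q_def matrix_mul_assoc)
    also have "\<dots> = (u k ** inv\<^bsub>SL\<^esub> (u k)) ** b k ** flow (n k)"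
      by (simp add: inv_SL_mult det_flow p_def matrix_mul_assoc)
    finally have "b k ** flow (n k) = u k ** (flow (n k) ** q k)"
      by (simp add: inv_SL_mult det_u)
    then have "b k ** flow (n k) ** inv\<^bsub>SL\<^esub> (q k) = u k ** flow (n k) ** (q k ** inv\<^bsub>SL\<^esub> (q k))"
      by (simp add: matrix_mul_assoc)
    then show ?thesis
      by (simp add: inv_SL_mult det_q flip: matrix_mul_assoc)
  qed
  ultimately have lim: "(\<lambda>k. \<gamma> k ** g ** (u k ** flow (n k))) \<longlonglongrightarrow> v"
    by simp
  have "u k ** flow (n k) \<in> H_group \<Delta>" for k
    unfolding u_def unipotent_part_def by (rule block_lower_flow_in_H_group[OF \<Delta>])
  then show thesis
    using \<gamma> by (intro that[OF _ _ lim] image_subsetI)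
qed

section \<open>Transfer to the orbits of \<Gamma> by inversion\<close>

theorem proposition1p1:
  fixes \<Gamma> :: "(real^('m::finite option)^('m option)) set"
    and \<Delta> :: "(real^'m^'m) set"
    and x\<^sub>0 :: "(real^('m option)^('m option)) set"
  assumes "CARD('m) \<ge> 2"
    and "lattice_in SL \<Gamma>"
    and "lattice_in SL \<Delta>"
    and "x\<^sub>0 \<in> rcosets\<^bsub>SL\<^esub> (H_group \<Delta>)"
  shows "coset_topology SL (H_group \<Delta>) closure_of {x\<^sub>0 #>\<^bsub>SL\<^esub> \<gamma> | \<gamma>. \<gamma> \<in> \<Gamma>}
           = rcosets\<^bsub>SL\<^esub> (H_group \<Delta>)"
proof
  let ?H = "H_group \<Delta>"
  interpret SL: group "SL :: (real^('m option)^('m option)) monoid" by (rule group_SL)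
  have \<Gamma>: "subgroup \<Gamma> SL" and \<Delta>: "subgroup \<Delta> SL"
    using assms by (auto simp: lattice_in_def)
  have H: "subgroup ?H SL"
    by (rule subgroup_H_group[OF \<Delta>])
  have det_\<Gamma>: "det \<gamma> = 1" if "\<gamma> \<in> \<Gamma>" for \<gamma>
    using that subgroup.subset[OF \<Gamma>] by auto
  have det_H: "det h = 1" if "h \<in> ?H" for h
    using that subgroup.subset[OF H] by auto
  obtain g where g: "det g = 1" "x\<^sub>0 = ?H #>\<^bsub>SL\<^esub> g"
    using assms(4) by (auto simp: RCOSETS_def)
  show "coset_topology SL ?H closure_of {x\<^sub>0 #>\<^bsub>SL\<^esub> \<gamma> | \<gamma>. \<gamma> \<in> \<Gamma>} \<subseteq> rcosets\<^bsub>SL\<^esub> ?H"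
    using closure_of_subset_topspace by fastforce
  show "rcosets\<^bsub>SL\<^esub> ?H \<subseteq> coset_topology SL ?H closure_of {x\<^sub>0 #>\<^bsub>SL\<^esub> \<gamma> | \<gamma>. \<gamma> \<in> \<Gamma>}"
  proof
    fix x assume x: "x \<in> rcosets\<^bsub>SL\<^esub> ?H"
    then obtain y where y: "det y = 1" "x = ?H #>\<^bsub>SL\<^esub> y"
      by (auto simp: RCOSETS_def)
    have one: "mat 1 \<in> \<Delta>"
      using subgroup.one_closed[OF \<Delta>] by simp
    obtain \<gamma> h where "range \<gamma> \<subseteq> \<Gamma>" "range h \<subseteq> ?H"
      and lim: "(\<lambda>k. \<gamma> k ** inv\<^bsub>SL\<^esub> g ** h k) \<longlonglongrightarrow> inv\<^bsub>SL\<^esub> y"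
      using lattice_orbit_approx[OF assms(2) one det_inv_SL[OF g(1)] det_inv_SL[OF y(1)]] .
    then have \<gamma>: "\<gamma> k \<in> \<Gamma>" and h: "h k \<in> ?H" for k
      by auto
    \<comment> \<open>This is the inverse of the approximating product, so it tends to y. Its left
      factor lies in H, hence its coset is the orbit point of x_0 under the inverse of
      \<open>\<gamma> k\<close>.\<close>
    define z where "z k = inv\<^bsub>SL\<^esub> (h k) ** (g ** inv\<^bsub>SL\<^esub> (\<gamma> k))" for k
    have dets: "det (\<gamma> k) = 1" "det (h k) = 1" for k
      by (rule det_\<Gamma>[OF \<gamma>], rule det_H[OF h])
    have det_z: "det (z k) = 1" for k
      by (simp add: z_def det_mul det_inv_SL dets g)
    have "inv\<^bsub>SL\<^esub> (\<gamma> k ** inv\<^bsub>SL\<^esub> g ** h k) = z k" for k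
      using SL.inv_mult_group[of "\<gamma> k ** inv\<^bsub>SL\<^esub> g" "h k"] SL.inv_mult_group[of "\<gamma> k" "inv\<^bsub>SL\<^esub> g"]
        SL.inv_inv[of g] g dets by (simp add: z_def det_mul det_inv_SL)
    then have "z \<longlonglongrightarrow> y"
      using tendsto_inv_SL[OF lim] SL.inv_inv[of y] y g dets by (simp add: det_mul det_inv_SL)
    have z_coset: "?H #>\<^bsub>SL\<^esub> z k = x\<^sub>0 #>\<^bsub>SL\<^esub> inv\<^bsub>SL\<^esub> (\<gamma> k)" for k
    proof -
      have "inv\<^bsub>SL\<^esub> (h k) \<in> ?H"
        using subgroup.m_inv_closed[OF H h] .
      then have "?H #>\<^bsub>SL\<^esub> z k = ?H #>\<^bsub>SL\<^esub> (g ** inv\<^bsub>SL\<^esub> (\<gamma> k))"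
        using SL_rcos_eq_iff[OF H det_z, of "g ** inv\<^bsub>SL\<^esub> (\<gamma> k)" k] g dets
        by (auto simp: z_def det_mul det_inv_SL)
      then show ?thesis
        using SL.coset_mult_assoc[of ?H g "inv\<^bsub>SL\<^esub> (\<gamma> k)"] subgroup.subset[OF H] g dets
        by (simp add: det_inv_SL)
    qed
    show "x \<in> coset_topology SL ?H closure_of {x\<^sub>0 #>\<^bsub>SL\<^esub> \<gamma> | \<gamma>. \<gamma> \<in> \<Gamma>}"
      unfolding in_closure_of topspace_coset_topology
    proof (intro conjI allI impI x)
      fix U assume U: "x \<in> U \<and> openin (coset_topology SL ?H) U"
      \<comment> \<open>Neighbourhoods in the quotient topology pull back to open sets of the group,
        so convergence of the representatives is enough.\<close>
      then have "openin (top_of_set (carrier SL)) {g. det g = 1 \<and> ?H #>\<^bsub>SL\<^esub> g \<in> U}"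
        by (simp add: openin_coset_topology_SL)
      then have "\<forall>\<^sub>F k in sequentially. z k \<in> {g. det g = 1 \<and> ?H #>\<^bsub>SL\<^esub> g \<in> U}"
        using \<open>z \<longlonglongrightarrow> y\<close> by (rule openin_tendstoD) (use U y det_z in auto)
      then obtain k where "?H #>\<^bsub>SL\<^esub> z k \<in> U"
        by (auto simp: eventually_sequentially)
      moreover have "inv\<^bsub>SL\<^esub> (\<gamma> k) \<in> \<Gamma>"
        using subgroup.m_inv_closed[OF \<Gamma> \<gamma>] .
      ultimately show "\<exists>y. y \<in> {x\<^sub>0 #>\<^bsub>SL\<^esub> \<gamma> | \<gamma>. \<gamma> \<in> \<Gamma>} \<and> y \<in> U"
        using z_coset by auto
    qed
  qed
qed

end
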